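(* Let $\mathbf X$ be an $\alpha$-rough path, let $\sigma_\mu\in C^N(\mathbb R^k,\mathbb R^k)$ for $\mu\in[d]$, and let $\mathbf Y$ be a coherent tree path. Then for any $f\in\mathcal F_{\le N-1}$, any $\mu\in[d]$ and all $s,t\in(0,1]$, $$R^{\sigma_\mu(\mathbf Y),f}_{s,t}=\boldsymbol\Upsilon_\mu[f](Y_t)-\Big\langle\mathbf X_{s,t},\,P_{\le N-|f|-1}\sum_{p=0}^{N-1}\frac1{p!}D^p\boldsymbol\Upsilon_\mu[f](Y_s)\big[\underbrace{(\boldsymbol\Upsilon(Y_s),\dots,\boldsymbol\Upsilon(Y_s))}_{p\text{ times}}\big]\Big\rangle .$$
   Context: Fix integers $d,k\ge 1$ and $\alpha\in(0,1)$; $N$ is the unique natural number with $N\alpha\le 1<(N+1)\alpha$; $[d]=\{1,\dots,d\}$. Trees and forests. Consider finite rooted trees (non-planar) with vertices decorated by elements of $[d]$. A forest is a finite, possibly empty, multiset of such trees, written as a commutative product; $\mathbf 1$ is the empty forest. For a forest $f$ and $\mu\in[d]$, $[f]_\mu$ is the tree obtained by joining the roots of all trees of $f$ to a new root decorated by $\mu$; every tree is uniquely of this form. $|f|$ is the number of vertices, $\#f$ the number of trees in $f$ (with multiplicity), $f_h$ the multiplicity of the tree $h$ in $f$; products over $h\in f$ are with multiplicity. $\mathring{\mathcal T}_{\le j}$ is the set of trees $h$ with $|h|\le j$, $\mathcal T_{\le j}=\mathring{\mathcal T}_{\le j}\cup\{\mathbf 1\}$, $\mathcal F$ is the set of forests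 all of whose trees lie in $\mathring{\mathcal T}_{\le N}$, $\mathcal F_{\le j}=\{f\in\mathcal F:|f|\le j\}$. $\mathrm{Span}(\mathcal F)$ is the free real vector space on $\mathcal F$, a commutative unital algebra under the forest product; $\langle\cdot,\cdot\rangle$ denotes the inner product making forests orthonormal, its tensor version, and duality pairings (applied componentwise to vectors). $P_{\le n}$ is the linear projection annihilating forests $f$ with $|f|>n$ and fixing the others. Coproduct. $\Delta$ is the multiplicative linear map with $\Delta\mathbf 1=\mathbf 1\otimes\mathbf 1$ and $\Delta[f]_\mu=[f]_\mu\otimes\mathbf 1+(\mathrm{id}\otimes[\,\cdot\,]_\mu)\Delta f$. Rough paths. An $\alpha$-rough path is a map $\mathbf X:[0,1]^2\to\mathrm{Char}$, where $\mathrm{Char}$ is the set of unital algebra homomorphisms $\mathrm{Span}(\mathcal F)\to\mathbb R$, such that $\langle\mathbf X_{s,u}\otimes\mathbf X_{u,t},\Delta h\rangle=\langle\mathbf X_{s,t},h\rangle$ for all $s,u,t\in[0,1]$, $h\in\mathcal T_{\le N}$, and $\sup_{s\ne t}|\langle\mathbf X_{s,t},h\rangle||s-t|^{-\alpha|h|}<\infty$ for all $h\in\mathring{\mathcal T}_{\le N}$. Tree and forest paths. A tree path (resp. forest path) is a map $\mathbf Y:[0,1]\to\mathrm{Span}(\mathcal T_{\le N-1})^k$ (resp. $\mathrm{Span}(\mathcal F_{\le N-1})^k$). Write $Y_s=\langle\mathbf 1,\mathbf Y_s\rangle\in\mathbb R^k$. The remainder of a tree or forest path $\mathbf Y$ at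 $f\in\mathcal F_{\le N-1}$ is $R^{\mathbf Y,f}_{s,t}=\langle f,\mathbf Y_t\rangle-\langle\mathbf X_{s,t}\otimes f,\Delta\mathbf Y_s\rangle\in\mathbb R^k$. For a tree path $\mathbf Y$ and $g\in C^{N-1}(\mathbb R^k,\mathbb R^k)$, $g(\mathbf Y)$ is the forest path $$g(\mathbf Y)_s=g(Y_s)\mathbf 1+P_{\le N-1}\sum_{p=1}^{N-1}\frac1{p!}\sum_{h_1,\dots,h_p\in\mathring{\mathcal T}_{\le N-1}}D^pg(Y_s)[\langle\mathbf Y_s,h_1\rangle,\dots,\langle\mathbf Y_s,h_p\rangle]\;h_1\cdots h_p .$$ A tree path $\mathbf Y$ is coherent if $\langle f,\sigma_\mu(\mathbf Y)_s\rangle=\langle[f]_\mu,\mathbf Y_s\rangle$ for all $[f]_\mu\in\mathring{\mathcal T}_{\le N-1}$ and $s\in(0,1]$. Elementary differentials. For $\mu\in[d]$ and $f=\prod_{i\in I}[f_i]_{\mu_i}\in\mathcal F_{\le N-1}$ define $\Upsilon_\mu[f]:\mathbb R^k\to\mathbb R^k$ inductively by $\Upsilon_\mu[f](y)=D^{|I|}\sigma_\mu(y)[(\Upsilon_{\mu_i}[f_i](y))_{i\in I}]$ (so $\Upsilon_\mu[\mathbf 1]=\sigma_\mu$), and $\Upsilon[[f]_\mu]=\Upsilon_\mu[f]$. Symmetry factors: $S(\mathbf 1)=1$, $S([f]_\mu)=S(f)$, $S(f)=\prod_h f_h!\,S(h)^{f_h}$. Set $\boldsymbol\Upsilon_\mu[f]=\Upsilon_\mu[f]/S(f)$,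 $\boldsymbol\Upsilon[h]=\Upsilon[h]/S(h)$ and $\boldsymbol\Upsilon(y)=\sum_{h\in\mathring{\mathcal T}_{\le N-1}}\boldsymbol\Upsilon[h](y)\,h$. The expression $D^p\boldsymbol\Upsilon_\mu[f](y)[(\boldsymbol\Upsilon(y),\dots,\boldsymbol\Upsilon(y))]$ means $$\sum_{h_1,\dots,h_p\in\mathring{\mathcal T}_{\le N-1}}D^p\boldsymbol\Upsilon_\mu[f](y)\big[\boldsymbol\Upsilon[h_1](y),\dots,\boldsymbol\Upsilon[h_p](y)\big]\;h_1\cdots h_p$$ (equal to $\boldsymbol\Upsilon_\mu[f](y)\mathbf 1$ for $p=0$); terms with $p>N-|f|-1$ are annihilated by $P_{\le N-|f|-1}$ and are taken to be $0$. *)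

theory Defs
  imports "HOL-Analysis.Analysis" "HOL-Analysis.Finite_Function_Topology"
begin

section \<open>Decorated trees and forests\<close>

text \<open>
  The decoration set is a finite type \<open>'d\<close> with \<open>d\<close> elements. A tree is non-planar because
  the branches at a vertex form a multiset: \<open>Node \<mu> f\<close> is \<open>[f]\<^sub>\<mu>\<close>. Forests are multisets, so
  the forest product is \<open>+\<close> and the empty forest is \<open>{#}\<close>. As \<open>+\<close> is the monoid operation used
  by finitely supported functions, \<open>'d forest \<Rightarrow>\<^sub>0 real\<close> carries the product extending the forest
  product, with unit \<open>1 = single {#} 1\<close>.
\<close>

datatype 'd rtree = Node 'd "'d rtree multiset"

type_synonym 'd forest = "'d rtree multiset"
type_synonym 'd forest_alg = "'d forest \<Rightarrow>\<^sub>0 real"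
type_synonym 'd forest_tensor = "('d forest \<times> 'd forest) \<Rightarrow>\<^sub>0 real"

primrec vertices :: "'d rtree \<Rightarrow> nat" where
  "vertices (Node \<mu> f) = 1 + sum_mset (image_mset vertices f)"

definition fsize :: "'d forest \<Rightarrow> nat" where
  "fsize f = (\<Sum>h\<in>#f. vertices h)"

lemma vertices_Node: "vertices (Node \<mu> f) = Suc (fsize f)"
  by (simp add: fsize_def)

lemma vertices_le_fsize: "h \<in># f \<Longrightarrow> vertices h \<le> fsize f"
  by (auto simp: fsize_def dest!: multi_member_split)

definition trees_le :: "nat \<Rightarrow> 'd rtree set" where
  "trees_le j = {h. vertices h \<le> j}"

definition trees_unit_le :: "nat \<Rightarrow> 'd forest set" where
  "trees_unit_le j = insert {#} ((\<lambda>h. {#h#}) ` trees_le j)"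

definition forests :: "nat \<Rightarrow> 'd forest set" where
  "forests N = {f. set_mset f \<subseteq> trees_le N}"

definition forests_le :: "nat \<Rightarrow> nat \<Rightarrow> 'd forest set" where
  "forests_le N j = {f \<in> forests N. fsize f \<le> j}"

definition Span :: "'d forest set \<Rightarrow> 'd forest_alg set" where
  "Span A = {a. Poly_Mapping.keys a \<subseteq> A}"

abbreviation basis :: "'a \<Rightarrow> ('a \<Rightarrow>\<^sub>0 real)" where
  "basis x \<equiv> Poly_Mapping.single x 1"

definition lin_ext :: "('a \<Rightarrow> 'b::real_vector) \<Rightarrow> ('a \<Rightarrow>\<^sub>0 real) \<Rightarrow> 'b" where
  "lin_ext F a = (\<Sum>x\<in>Poly_Mapping.keys a. Poly_Mapping.lookup a x *\<^sub>R F x)"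

definition proj_le :: "nat \<Rightarrow> 'd forest_alg \<Rightarrow> 'd forest_alg" where
  "proj_le n = lin_ext (\<lambda>f. if fsize f \<le> n then basis f else 0)"


section \<open>Coproduct\<close>

text \<open>
  The tensor square is spanned by pairs of forests; its product extends componentwise addition of
  pairs, i.e. it is the tensor product algebra structure.
\<close>

definition id_tensor_graft :: "'d \<Rightarrow> 'd forest_tensor \<Rightarrow> 'd forest_tensor" where
  "id_tensor_graft \<mu> = lin_ext (\<lambda>(a, b). basis (a, {#Node \<mu> b#}))"

primrec coprod_tree :: "'d rtree \<Rightarrow> 'd forest_tensor" where
  "coprod_tree (Node \<mu> f) =
     basis ({#Node \<mu> f#}, {#}) + id_tensor_graft \<mu> (prod_mset (image_mset coprod_tree f))"

definition coprod_forest :: "'d forest \<Rightarrow> 'd forest_tensor" where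
  "coprod_forest f = (\<Prod>h\<in>#f. coprod_tree h)"

definition coprod :: "'d forest_alg \<Rightarrow> 'd forest_tensor" where
  "coprod = lin_ext coprod_forest"

lemma coprod_tree_Node:
  "coprod_tree (Node \<mu> f) =
     basis ({#Node \<mu> f#}, {#}) + id_tensor_graft \<mu> (coprod_forest f)"
  by (simp add: coprod_forest_def)

text \<open>The pairing of \<open>\<phi> \<otimes> \<psi>\<close>, for linear functionals \<open>\<phi>\<close> and \<open>\<psi>\<close>, with a tensor.\<close>

definition tensor_pair ::
    "('d forest_alg \<Rightarrow> real) \<Rightarrow> ('d forest_alg \<Rightarrow> real) \<Rightarrow> 'd forest_tensor \<Rightarrow> real" where
  "tensor_pair \<phi> \<psi> = lin_ext (\<lambda>(a, b). \<phi> (basis a) * \<psi> (basis b))"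

definition dual :: "'d forest \<Rightarrow> 'd forest_alg \<Rightarrow> real" where
  "dual f a = Poly_Mapping.lookup a f"


section \<open>Rough paths\<close>

definition character :: "nat \<Rightarrow> ('d forest_alg \<Rightarrow> real) \<Rightarrow> bool" where
  "character N \<phi> \<longleftrightarrow>
     (\<forall>a\<in>Span (forests N). \<forall>b\<in>Span (forests N). \<phi> (a + b) = \<phi> a + \<phi> b) \<and>
     (\<forall>c. \<forall>a\<in>Span (forests N). \<phi> (c *\<^sub>R a) = c * \<phi> a) \<and>
     (\<forall>a\<in>Span (forests N). \<forall>b\<in>Span (forests N). \<phi> (a * b) = \<phi> a * \<phi> b) \<and>
     \<phi> 1 = 1"

definition rough_path :: "real \<Rightarrow> nat \<Rightarrow> (real \<Rightarrow> real \<Rightarrow> 'd forest_alg \<Rightarrow> real) \<Rightarrow> bool" where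
  "rough_path \<alpha> N X \<longleftrightarrow>
     (\<forall>s\<in>{0..1}. \<forall>t\<in>{0..1}. character N (X s t)) \<and>
     (\<forall>s\<in>{0..1}. \<forall>u\<in>{0..1}. \<forall>t\<in>{0..1}. \<forall>h\<in>trees_unit_le N.
        tensor_pair (X s u) (X u t) (coprod (basis h)) = X s t (basis h)) \<and>
     (\<forall>h\<in>trees_le N.
        bdd_above {\<bar>X s t (basis {#h#})\<bar> * \<bar>s - t\<bar> powr (- (\<alpha> * real (vertices h))) | s t.
          s \<in> {0..1} \<and> t \<in> {0..1} \<and> s \<noteq> t})"


section \<open>Higher derivatives\<close>

text \<open>
  \<open>nderiv g [v\<^sub>1, \<dots>, v\<^sub>p] y\<close> is \<open>D\<^sup>pg(y)[v\<^sub>1, \<dots>, v\<^sub>p]\<close>, the derivative at \<open>y\<close> in direction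
  \<open>v\<^sub>1\<close> of \<open>z \<mapsto> D\<^sup>p\<^sup>-\<^sup>1g(z)[v\<^sub>2, \<dots>, v\<^sub>p]\<close>. It is total, with unspecified values
  where \<open>g\<close> is not \<open>p\<close> times differentiable.
\<close>

primrec nderiv ::
    "('a::real_normed_vector \<Rightarrow> 'b::real_normed_vector) \<Rightarrow> 'a list \<Rightarrow> 'a \<Rightarrow> 'b" where
  "nderiv g [] = g"
| "nderiv g (v # vs) = (\<lambda>y. frechet_derivative (nderiv g vs) (at y) v)"

text \<open>
  \<open>D\<^sup>pg(y)\<close> applied to an unordered family of directions. The order chosen is irrelevant when
  \<open>g\<close> is of class \<open>C\<^sup>p\<close>, by symmetry of \<open>D\<^sup>pg(y)\<close>.
\<close>

definition nderiv_mset ::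
    "('a::real_normed_vector \<Rightarrow> 'b::real_normed_vector) \<Rightarrow> 'a multiset \<Rightarrow> 'a \<Rightarrow> 'b" where
  "nderiv_mset g M = nderiv g (SOME vs. mset vs = M)"

text \<open>
  The class \<open>C\<^sup>n\<close> on a finite-dimensional space, where continuity of \<open>y \<mapsto> Dg(y)\<close> in operator norm
  is the same as continuity of \<open>y \<mapsto> Dg(y)[v]\<close> for every \<open>v\<close>.
\<close>

primrec class_C ::
    "nat \<Rightarrow> ('a::euclidean_space \<Rightarrow> 'b::euclidean_space) \<Rightarrow> bool" where
  "class_C 0 g \<longleftrightarrow> continuous_on UNIV g"
| "class_C (Suc n) g \<longleftrightarrow> (\<forall>y. g differentiable (at y)) \<and>
     (\<forall>v. class_C n (\<lambda>y. frechet_derivative g (at y) v))"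


section \<open>Tree and forest paths\<close>

text \<open>
  Elements of \<open>Span(\<dots>)\<^sup>k\<close> are vectors indexed by a finite type \<open>'k\<close> with \<open>k\<close> elements.
  The next three definitions are componentwise: the vector-valued pairing, the product
  \<open>v f\<close> of \<open>v \<in> \<real>\<^sup>k\<close> with an element of the algebra, and the projection.
\<close>

definition pair_vec :: "('d forest_alg \<Rightarrow> real) \<Rightarrow> ('d forest_alg)^'k \<Rightarrow> real^'k" where
  "pair_vec \<phi> Z = (\<chi> i. \<phi> (Z $ i))"

definition vec_scale :: "real^'k \<Rightarrow> 'd forest_alg \<Rightarrow> ('d forest_alg)^'k" where
  "vec_scale v a = (\<chi> i. (v $ i) *\<^sub>R a)"

definition proj_vec_le :: "nat \<Rightarrow> ('d forest_alg)^'k \<Rightarrow> ('d forest_alg)^'k" where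
  "proj_vec_le n Z = (\<chi> i. proj_le n (Z $ i))"

abbreviation coeff_vec :: "'d forest \<Rightarrow> ('d forest_alg)^'k \<Rightarrow> real^'k" where
  "coeff_vec f \<equiv> pair_vec (dual f)"

definition tree_path :: "nat \<Rightarrow> (real \<Rightarrow> ('d forest_alg)^'k) \<Rightarrow> bool" where
  "tree_path N Y \<longleftrightarrow> (\<forall>s\<in>{0..1}. \<forall>i. Y s $ i \<in> Span (trees_unit_le (N - 1)))"

text \<open>\<open>R\<^bsup>Y,f\<^esup>\<^sub>s\<^sub>,\<^sub>t\<close> for a tree or forest path \<open>Y\<close>.\<close>

definition remainder ::
    "(real \<Rightarrow> real \<Rightarrow> 'd forest_alg \<Rightarrow> real) \<Rightarrow> (real \<Rightarrow> ('d forest_alg)^'k) \<Rightarrow>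
       'd forest \<Rightarrow> real \<Rightarrow> real \<Rightarrow> real^'k" where
  "remainder X Y f s t =
     coeff_vec f (Y t) - (\<chi> i. tensor_pair (X s t) (dual f) (coprod (Y s $ i)))"

text \<open>
  \<open>deriv_expand N p g y W\<close> is \<open>D\<^sup>pg(y)[W, \<dots>, W]\<close>, with the coefficients of \<open>W\<close> as directions:
  the sum over \<open>p\<close>-tuples of trees with at most \<open>N - 1\<close> vertices of
  \<open>D\<^sup>pg(y)[\<langle>W, h\<^sub>1\<rangle>, \<dots>, \<langle>W, h\<^sub>p\<rangle>] h\<^sub>1\<cdots>h\<^sub>p\<close>.
\<close>

definition deriv_expand ::
    "nat \<Rightarrow> nat \<Rightarrow> (real^'k \<Rightarrow> real^'k) \<Rightarrow> real^'k \<Rightarrow> ('d forest_alg)^'k \<Rightarrow> ('d forest_alg)^'k" where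
  "deriv_expand N p g y W =
     (\<Sum>hs | length hs = p \<and> set hs \<subseteq> trees_le (N - 1).
        vec_scale (nderiv g (map (\<lambda>h. coeff_vec {#h#} W) hs) y) (basis (mset hs)))"

definition compose_path ::
    "nat \<Rightarrow> (real^'k \<Rightarrow> real^'k) \<Rightarrow> (real \<Rightarrow> ('d forest_alg)^'k) \<Rightarrow> real \<Rightarrow> ('d forest_alg)^'k" where
  "compose_path N g Y s =
     vec_scale (g (coeff_vec {#} (Y s))) 1 +
     proj_vec_le (N - 1)
       (\<Sum>p=1..N - 1. (1 / fact p) *\<^sub>R deriv_expand N p g (coeff_vec {#} (Y s)) (Y s))"

definition coherent ::
    "nat \<Rightarrow> ('d \<Rightarrow> real^'k \<Rightarrow> real^'k) \<Rightarrow> (real \<Rightarrow> ('d forest_alg)^'k) \<Rightarrow> bool" where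
  "coherent N \<sigma> Y \<longleftrightarrow>
     (\<forall>\<mu> f. Node \<mu> f \<in> trees_le (N - 1) \<longrightarrow>
        (\<forall>s\<in>{0<..1}. coeff_vec f (compose_path N (\<sigma> \<mu>) Y s) = coeff_vec {#Node \<mu> f#} (Y s)))"


section \<open>Elementary differentials\<close>

primrec eldiff_tree :: "('d \<Rightarrow> real^'k \<Rightarrow> real^'k) \<Rightarrow> 'd rtree \<Rightarrow> real^'k \<Rightarrow> real^'k" where
  "eldiff_tree \<sigma> (Node \<mu> f) =
     (\<lambda>y. nderiv_mset (\<sigma> \<mu>) (image_mset (\<lambda>u. u y) (image_mset (eldiff_tree \<sigma>) f)) y)"

definition eldiff :: "('d \<Rightarrow> real^'k \<Rightarrow> real^'k) \<Rightarrow> 'd \<Rightarrow> 'd forest \<Rightarrow> real^'k \<Rightarrow> real^'k" where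
  "eldiff \<sigma> \<mu> f = eldiff_tree \<sigma> (Node \<mu> f)"

lemma eldiff_eq:
  "eldiff \<sigma> \<mu> f y = nderiv_mset (\<sigma> \<mu>) (image_mset (\<lambda>h. eldiff_tree \<sigma> h y) f) y"
  by (simp add: eldiff_def image_mset.compositionality o_def)

lemma eldiff_empty: "eldiff \<sigma> \<mu> {#} = \<sigma> \<mu>"
  by (simp add: eldiff_def nderiv_mset_def)

function sym_tree :: "'d rtree \<Rightarrow> nat" where
  "sym_tree (Node \<mu> f) = (\<Prod>h\<in>set_mset f. fact (count f h) * sym_tree h ^ count f h)"
  by pat_completeness auto
termination
  by (relation "Wellfounded.measure vertices")
     (auto simp: vertices_Node less_Suc_eq_le vertices_le_fsize simp del: vertices.simps)

definition sym_forest :: "'d forest \<Rightarrow> nat" where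
  "sym_forest f = (\<Prod>h\<in>set_mset f. fact (count f h) * sym_tree h ^ count f h)"

lemma sym_tree_Node: "sym_tree (Node \<mu> f) = sym_forest f"
  by (simp add: sym_forest_def)

text \<open>The versions normalised by the symmetry factor (in bold type on paper).\<close>

definition neldiff :: "('d \<Rightarrow> real^'k \<Rightarrow> real^'k) \<Rightarrow> 'd \<Rightarrow> 'd forest \<Rightarrow> real^'k \<Rightarrow> real^'k" where
  "neldiff \<sigma> \<mu> f y = (1 / real (sym_forest f)) *\<^sub>R eldiff \<sigma> \<mu> f y"

definition neldiff_tree :: "('d \<Rightarrow> real^'k \<Rightarrow> real^'k) \<Rightarrow> 'd rtree \<Rightarrow> real^'k \<Rightarrow> real^'k" where
  "neldiff_tree \<sigma> h y = (1 / real (sym_tree h)) *\<^sub>R eldiff_tree \<sigma> h y"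

definition neldiff_sum ::
    "nat \<Rightarrow> ('d \<Rightarrow> real^'k \<Rightarrow> real^'k) \<Rightarrow> real^'k \<Rightarrow> ('d forest_alg)^'k" where
  "neldiff_sum N \<sigma> y = (\<Sum>h\<in>trees_le (N - 1). vec_scale (neldiff_tree \<sigma> h y) (basis {#h#}))"


section \<open>Finiteness of the index sets\<close>

lemma size_le_fsize: "size f \<le> fsize f"
proof (induction f)
  case (add h f)
  then show ?case by (cases h) (auto simp: fsize_def)
qed (simp add: fsize_def)

lemma finite_trees_le: "finite (trees_le n :: 'd::finite rtree set)"
proof (induction n)
  case 0
  have "trees_le 0 = ({} :: 'd rtree set)"
  proof -
    have "vertices h \<noteq> 0" for h :: "'d rtree" by (cases h) simp
    then show ?thesis by (simp add: trees_le_def)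
  qed
  then show ?case by simp
next
  case (Suc n)
  let ?L = "{hs :: 'd rtree list. set hs \<subseteq> trees_le n \<and> length hs \<le> n}"
  have "trees_le (Suc n) \<subseteq> (\<lambda>(\<mu>, hs). Node \<mu> (mset hs)) ` ((UNIV :: 'd set) \<times> ?L)"
  proof
    fix h :: "'d rtree"
    assume h: "h \<in> trees_le (Suc n)"
    obtain \<mu> f where hf: "h = Node \<mu> f" by (cases h)
    have f: "fsize f \<le> n" using h by (simp add: hf trees_le_def vertices_Node del: vertices.simps)
    obtain hs where hs: "mset hs = f" by (metis ex_mset)
    have "set hs \<subseteq> trees_le n"
      using f hs vertices_le_fsize[of _ f] by (fastforce simp: trees_le_def)
    moreover have "length hs \<le> n" using f hs size_le_fsize[of f] by auto
    ultimately show "h \<in> (\<lambda>(\<mu>, hs). Node \<mu> (mset hs)) ` (UNIV \<times> ?L)"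
      using hf hs by (intro image_eqI[of _ _ "(\<mu>, hs)"]) auto
  qed
  moreover have "finite ?L" using Suc finite_lists_length_le by blast
  ultimately show ?case by (auto intro: finite_subset)
qed

end

theory Submission
  imports Defs "HOL-Combinatorics.Multiset_Permutations"
begin

text \<open>
  Write \<open>M = N - 1\<close>, \<open>[.]\<^sub>\<nu>\<close> for grafting, and \<open>\<Upsilon>\<close> for the elementary differentials normalised by
  the symmetry factors.

  Coherence determines the path. The coefficient of \<open>\<sigma>\<^sub>\<mu>(Y)\<^sub>s\<close> at a forest \<open>f\<close> collects
  \<open>1/p!\<close> times one derivative of \<open>\<sigma>\<^sub>\<mu>\<close> for each ordering of the \<open>p\<close> trees of \<open>f\<close>, all equal by
  symmetry of higher derivatives. There are \<open>p! / \<Prod>\<^sub>h f\<^sub>h!\<close> orderings, and the factors \<open>f\<^sub>h!\<close> are those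
  of the symmetry factor. By induction on the size of trees, \<open>Y\<^sub>s\<close> has the coefficient
  \<open>\<Upsilon>[h](y)\<close> at each tree \<open>h\<close>, where \<open>y\<close> is its coefficient at the empty forest (\<open>coherent_coeff\<close>),
  and \<open>\<sigma>\<^sub>\<mu>(Y)\<^sub>s\<close> is the truncation of
  \<open>P\<^sub>\<mu>(y) = \<Sum>\<^sub>f \<Upsilon>\<^sub>\<mu>[f](y) f\<close>. This series is the Taylor expansion of \<open>\<sigma>\<^sub>\<mu>\<close> at \<open>y\<close> with
  algebra-valued increment \<open>\<Upsilon>(y) = \<Sum>\<^sub>h \<Upsilon>[h](y) h\<close>.

  The first term of the remainder is thereby \<open>\<Upsilon>\<^sub>\<mu>[f](Y\<^sub>t)\<close>. For the second, let \<open>T\<close> be the operator that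
  expands a function at \<open>y\<close> with increment \<open>\<Upsilon>(y)\<close>. The claim is that the coproduct re-expands:
  \<open>\<Delta> P\<^sub>\<mu>(y) = \<Sum>\<^sub>f T(\<Upsilon>\<^sub>\<mu>[f]) \<otimes> f\<close> in degrees up to \<open>M\<close> (\<open>coprod_taylor_eldiff_gen\<close>). Both sides
  solve the same fixed point equation
  \<open>Z\<^sub>\<mu> = \<sigma>\<^sub>\<mu>(y + \<Upsilon>(y) \<otimes> 1 + \<Sum>\<^sub>\<nu> (id \<otimes> [.]\<^sub>\<nu>) Z\<^sub>\<nu>)\<close>, the right-hand side being read as a Taylor
  expansion at \<open>y\<close>.
  For the left side this is the recursive definition of \<open>\<Delta>\<close>, an algebra morphism and hence compatible with
  Taylor expansion. For the right side it holds because \<open>T\<close> is multiplicative, by the Leibniz rule: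
  applied coefficient by coefficient to the forest-valued function \<open>z \<mapsto> P\<^sub>\<mu>(z)\<close>, it adds its own
  increment to that of the inner expansion (\<open>coeff_taylor_taylor\<close>). As grafting raises the degree
  by one, two solutions that agree below degree \<open>n\<close> agree below degree \<open>n + 1\<close>, so the solution is unique.

  Since the \<open>\<sigma>\<^sub>\<mu>\<close> have finitely many derivatives, all of this is done modulo high degree: \<open>\<Upsilon>\<^sub>\<mu>[f]\<close>
  has at least \<open>M - |f|\<close> continuous derivatives, which are just those seen by the terms \<open>a \<otimes> f\<close> of degree
  at most \<open>M\<close>. Pairing the left factor with \<open>X\<^sub>s\<^sub>,\<^sub>t\<close> and reading off the coefficient of \<open>f\<close> in the right
  one gives the theorem.
\<close>

section \<open>Directional derivatives of functions of class C\<close>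

definition dir_deriv ::
    "'a::real_normed_vector \<Rightarrow> ('a \<Rightarrow> 'b::real_normed_vector) \<Rightarrow> 'a \<Rightarrow> 'b" where
  "dir_deriv v g = (\<lambda>y. frechet_derivative g (at y) v)"

lemma nderiv_Cons: "nderiv g (v # vs) = dir_deriv v (nderiv g vs)"
  by (simp add: dir_deriv_def)

lemma nderiv_append: "nderiv g (vs @ ws) = nderiv (nderiv g ws) vs"
  by (induction vs) simp_all

lemma nderiv_snoc: "nderiv g (vs @ [w]) = nderiv (dir_deriv w g) vs"
  by (simp add: nderiv_append dir_deriv_def)

lemma class_C_SucI:
  assumes "\<And>y. g differentiable (at y)" and "\<And>v. class_C n (dir_deriv v g)"
  shows "class_C (Suc n) g"
  using assms by (simp add: dir_deriv_def)

lemma class_C_differentiable: "class_C (Suc n) g \<Longrightarrow> g differentiable (at y)"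
  by simp

lemma class_C_dir_deriv: "class_C (Suc n) g \<Longrightarrow> class_C n (dir_deriv v g)"
  by (simp add: dir_deriv_def)

\<comment> \<open>The class is used through \<open>dir_deriv\<close>; unfolding would expose raw Frechet derivatives.\<close>
declare class_C.simps(2) [simp del]

lemma class_C_continuous: "class_C n g \<Longrightarrow> continuous_on UNIV g"
  by (cases n)
    (auto simp: class_C.simps(2) continuous_on_eq_continuous_at intro: differentiable_imp_continuous_within)

lemma class_C_Suc_imp: "class_C (Suc n) g \<Longrightarrow> class_C n g"
proof (induction n arbitrary: g)
  case 0
  then show ?case using class_C_continuous[of "Suc 0" g] by simp
next
  case (Suc n)
  show ?case
  proof (rule class_C_SucI)
    show "g differentiable (at y)" for y
      using Suc.prems class_C_differentiable by blast
    show "class_C n (dir_deriv v g)" for v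
      using Suc.IH class_C_dir_deriv[OF Suc.prems] by blast
  qed
qed

lemma class_C_mono: "class_C n g \<Longrightarrow> m \<le> n \<Longrightarrow> class_C m g"
  by (rule dec_induct[of m n "\<lambda>i. class_C i g \<longrightarrow> class_C m g", THEN mp])
    (auto intro: class_C_Suc_imp)

lemma dir_deriv_eq:
  assumes "(g has_derivative g') (at y)"
  shows "dir_deriv v g y = g' v"
  using frechet_derivative_at[OF assms] by (simp add: dir_deriv_def)

lemma has_derivative_dir_deriv:
  assumes "g differentiable (at y)"
  shows "(g has_derivative (\<lambda>v. dir_deriv v g y)) (at y)"
  using assms by (simp add: frechet_derivative_works dir_deriv_def)

lemma dir_deriv_const [simp]: "dir_deriv v (\<lambda>_. c) = (\<lambda>_. 0)"
  by (simp add: dir_deriv_def)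

lemma dir_deriv_add:
  assumes "\<And>y. g differentiable (at y)" and "\<And>y. h differentiable (at y)"
  shows "dir_deriv v (\<lambda>y. g y + h y) = (\<lambda>y. dir_deriv v g y + dir_deriv v h y)"
  by (rule ext, rule dir_deriv_eq, rule has_derivative_add)
    (use assms has_derivative_dir_deriv in auto)

lemma dir_deriv_sum:
  assumes "\<And>i y. i \<in> I \<Longrightarrow> g i differentiable (at y)"
  shows "dir_deriv v (\<lambda>y. \<Sum>i\<in>I. g i y) = (\<lambda>y. \<Sum>i\<in>I. dir_deriv v (g i) y)"
  by (rule ext, rule dir_deriv_eq, rule has_derivative_sum)
    (use assms has_derivative_dir_deriv in auto)

lemma dir_deriv_linear:
  assumes "bounded_linear L" and "\<And>y. g differentiable (at y)"
  shows "dir_deriv v (\<lambda>y. L (g y)) = (\<lambda>y. L (dir_deriv v g y))"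
  by (rule ext, rule dir_deriv_eq)
    (rule bounded_linear.has_derivative[OF assms(1) has_derivative_dir_deriv[OF assms(2)]])

lemma dir_deriv_mult:
  fixes g h :: "'a::real_normed_vector \<Rightarrow> real"
  assumes "\<And>y. g differentiable (at y)" and "\<And>y. h differentiable (at y)"
  shows "dir_deriv v (\<lambda>y. g y * h y) = (\<lambda>y. dir_deriv v g y * h y + g y * dir_deriv v h y)"
proof
  fix y
  show "dir_deriv v (\<lambda>y. g y * h y) y = dir_deriv v g y * h y + g y * dir_deriv v h y"
    using dir_deriv_eq[OF has_derivative_mult[OF has_derivative_dir_deriv has_derivative_dir_deriv],
        OF assms, of v y] by simp
qed

lemma dir_deriv_direction_sum:
  assumes "\<And>y. g differentiable (at y)"
  shows "dir_deriv (\<Sum>i\<in>I. c i *\<^sub>R v i) g = (\<lambda>y. \<Sum>i\<in>I. c i *\<^sub>R dir_deriv (v i) g y)"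
proof
  fix y
  have l: "linear (frechet_derivative g (at y))"
    using assms by (rule linear_frechet_derivative)
  show "dir_deriv (\<Sum>i\<in>I. c i *\<^sub>R v i) g y = (\<Sum>i\<in>I. c i *\<^sub>R dir_deriv (v i) g y)"
    by (simp add: dir_deriv_def linear_sum[OF l] linear_scale[OF l])
qed

lemma class_C_const [simp]: "class_C n (\<lambda>_. c)"
  by (induction n arbitrary: c) (auto simp: class_C.simps(2))

lemma class_C_add:
  assumes "class_C n g" and "class_C n h"
  shows "class_C n (\<lambda>y. g y + h y)"
  using assms
proof (induction n arbitrary: g h)
  case 0
  then show ?case by (auto intro: continuous_on_add)
next
  case (Suc n)
  have d: "g differentiable (at y)" "h differentiable (at y)" for y
    using Suc.prems class_C_differentiable by auto
  show ?case
    by (rule class_C_SucI)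
      (auto simp: dir_deriv_add d intro!: Suc.IH class_C_dir_deriv Suc.prems)
qed

lemma class_C_linear:
  assumes "bounded_linear L" and "class_C n g"
  shows "class_C n (\<lambda>y. L (g y))"
  using assms(2)
proof (induction n arbitrary: g)
  case 0
  then show ?case
    using bounded_linear.continuous_on[OF assms(1)] by auto
next
  case (Suc n)
  have d: "g differentiable (at y)" for y
    using Suc.prems class_C_differentiable by auto
  have "(\<lambda>y. L (g y)) differentiable (at y)" for y
    using bounded_linear.has_derivative[OF assms(1) has_derivative_dir_deriv[OF d]]
    by (blast intro: differentiableI)
  then show ?case
    by (intro class_C_SucI)
      (auto simp: dir_deriv_linear[OF assms(1)] d intro!: Suc.IH class_C_dir_deriv Suc.prems)
qed

lemma class_C_sum:
  assumes "\<And>i. i \<in> I \<Longrightarrow> class_C n (g i)"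
  shows "class_C n (\<lambda>y. \<Sum>i\<in>I. g i y)"
  using assms
  by (induction I rule: infinite_finite_induct) (auto intro: class_C_add)

lemma class_C_mult:
  fixes g h :: "'a::euclidean_space \<Rightarrow> real"
  assumes "class_C n g" and "class_C n h"
  shows "class_C n (\<lambda>y. g y * h y)"
  using assms
proof (induction n arbitrary: g h)
  case 0
  then show ?case by (auto intro: continuous_on_mult)
next
  case (Suc n)
  have d: "g differentiable (at y)" "h differentiable (at y)" for y
    using Suc.prems class_C_differentiable by auto
  have "class_C n (\<lambda>y. dir_deriv v g y * h y)" "class_C n (\<lambda>y. g y * dir_deriv v h y)" for v
    using Suc.IH Suc.prems class_C_Suc_imp class_C_dir_deriv by blast+
  then show ?case
    by (intro class_C_SucI) (use d in \<open>auto simp: dir_deriv_mult intro: class_C_add\<close>)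
qed

lemma class_C_nderiv: "class_C (n + length vs) g \<Longrightarrow> class_C n (nderiv g vs)"
  by (induction vs arbitrary: n)
    (auto simp: nderiv_Cons simp del: nderiv.simps(2) intro!: class_C_dir_deriv simp flip: add_Suc)

lemma nderiv_linear:
  assumes "bounded_linear L" and "class_C (length vs) g"
  shows "nderiv (\<lambda>y. L (g y)) vs = (\<lambda>y. L (nderiv g vs y))"
  using assms(2)
proof (induction vs)
  case (Cons v vs)
  have "class_C (length vs) g"
    using Cons.prems class_C_Suc_imp by simp
  moreover have "class_C (Suc 0) (nderiv g vs)"
    using Cons.prems by (intro class_C_nderiv) simp
  ultimately show ?case
    using Cons.IH dir_deriv_linear[OF assms(1), of "nderiv g vs"] class_C_differentiable
    by (simp only: nderiv_Cons) blast
qed simp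

lemma nderiv_component:
  fixes g :: "'a::euclidean_space \<Rightarrow> real^'k"
  assumes "class_C (length vs) g"
  shows "nderiv (\<lambda>y. g y $ i) vs y = nderiv g vs y $ i"
  using nderiv_linear[OF bounded_linear_vec_nth assms] by metis

lemma nderiv_scaleR:
  assumes "class_C (length vs) g"
  shows "nderiv (\<lambda>y. c *\<^sub>R g y) vs = (\<lambda>y. c *\<^sub>R nderiv g vs y)"
  using nderiv_linear[OF bounded_linear_scaleR_right assms] .

lemma nderiv_sum:
  assumes "\<And>i. i \<in> I \<Longrightarrow> class_C (length vs) (g i)"
  shows "nderiv (\<lambda>y. \<Sum>i\<in>I. g i y) vs = (\<lambda>y. \<Sum>i\<in>I. nderiv (g i) vs y)"
  using assms
proof (induction vs)
  case (Cons v vs)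
  have *: "nderiv (\<lambda>y. \<Sum>i\<in>I. g i y) vs = (\<lambda>y. \<Sum>i\<in>I. nderiv (g i) vs y)"
    using Cons.prems by (intro Cons.IH) (simp add: class_C_Suc_imp)
  have "class_C (Suc 0) (nderiv (g i) vs)" if "i \<in> I" for i
    using Cons.prems that by (intro class_C_nderiv) simp
  then show ?case
    unfolding nderiv_Cons * using class_C_differentiable by (intro dir_deriv_sum) blast
qed simp

text \<open>
  The second difference of \<open>g\<close> over the parallelogram with sides \<open>\<epsilon> u\<close> and \<open>\<epsilon> v\<close> is the difference of
  \<open>\<phi> r = g (x + r u + \<epsilon> v) - g (x + r u)\<close> between \<open>0\<close> and \<open>\<epsilon>\<close>. Apply the mean value theorem to \<open>\<phi>\<close>,
  and then to the derivative of \<open>g\<close> in direction \<open>u\<close> along the side \<open>v\<close>.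
\<close>

lemma second_difference_mean_value:
  fixes g :: "'a::euclidean_space \<Rightarrow> real"
  assumes g: "class_C 2 g" and "0 < \<epsilon>"
  shows "\<exists>\<xi> \<eta>. 0 < \<xi> \<and> \<xi> < \<epsilon> \<and> 0 < \<eta> \<and> \<eta> < \<epsilon> \<and>
    g (x + \<epsilon> *\<^sub>R u + \<epsilon> *\<^sub>R v) - g (x + \<epsilon> *\<^sub>R u) - g (x + \<epsilon> *\<^sub>R v) + g x =
      \<epsilon> * (\<epsilon> * dir_deriv v (dir_deriv u g) (x + \<xi> *\<^sub>R u + \<eta> *\<^sub>R v))"
proof -
  have g1: "class_C (Suc (Suc 0)) g" using g by (simp only: numeral_2_eq_2)
  have d: "g differentiable (at y)" for y using class_C_differentiable[OF g1] .
  have du: "dir_deriv u g differentiable (at y)" for y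
    using class_C_differentiable[OF class_C_dir_deriv[OF g1]] .
  define \<phi> where "\<phi> r = g (x + r *\<^sub>R u + \<epsilon> *\<^sub>R v) - g (x + r *\<^sub>R u)" for r
  have line: "((\<lambda>r. h (a + r *\<^sub>R w)) has_real_derivative dir_deriv w h (a + r *\<^sub>R w)) (at r)"
    if h: "\<And>y. h differentiable (at y)" for h :: "'a \<Rightarrow> real" and a w r
  proof -
    have "((\<lambda>r. a + r *\<^sub>R w) has_derivative (\<lambda>r. r *\<^sub>R w)) (at r)"
      by (auto intro!: derivative_eq_intros)
    then have "((\<lambda>r. h (a + r *\<^sub>R w)) has_derivative
        (\<lambda>r'. dir_deriv (r' *\<^sub>R w) h (a + r *\<^sub>R w))) (at r)"
      using diff_chain_at[OF _ has_derivative_dir_deriv[OF h]] by (auto simp: o_def)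
    moreover have "dir_deriv (r' *\<^sub>R w) h y = r' *\<^sub>R dir_deriv w h y" for r' y
      using linear_scale[OF linear_frechet_derivative[OF h]] by (simp add: dir_deriv_def)
    ultimately show ?thesis
      by (simp add: has_field_derivative_def mult.commute[of _ "dir_deriv w h (a + r *\<^sub>R w)"])
  qed
  have "((\<lambda>r. g (x + r *\<^sub>R u + \<epsilon> *\<^sub>R v)) has_real_derivative
      dir_deriv u g (x + r *\<^sub>R u + \<epsilon> *\<^sub>R v)) (at r)" for r
    using line[of g "x + \<epsilon> *\<^sub>R v" u r] d by (simp add: ac_simps)
  then have \<phi>': "(\<phi> has_real_derivative
      dir_deriv u g (x + r *\<^sub>R u + \<epsilon> *\<^sub>R v) - dir_deriv u g (x + r *\<^sub>R u)) (at r)" for r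
    unfolding \<phi>_def using line[of g x u r] d by (intro DERIV_diff) auto
  obtain \<xi> where \<xi>: "0 < \<xi>" "\<xi> < \<epsilon>"
    "\<phi> \<epsilon> - \<phi> 0 = \<epsilon> * (dir_deriv u g (x + \<xi> *\<^sub>R u + \<epsilon> *\<^sub>R v) - dir_deriv u g (x + \<xi> *\<^sub>R u))"
    using MVT2[of 0 \<epsilon> \<phi>, OF \<open>0 < \<epsilon>\<close> \<phi>'] by auto
  obtain \<eta> where \<eta>: "0 < \<eta>" "\<eta> < \<epsilon>"
    "dir_deriv u g (x + \<xi> *\<^sub>R u + \<epsilon> *\<^sub>R v) - dir_deriv u g (x + \<xi> *\<^sub>R u) =
      \<epsilon> * dir_deriv v (dir_deriv u g) (x + \<xi> *\<^sub>R u + \<eta> *\<^sub>R v)"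
    using MVT2[of 0 \<epsilon> "\<lambda>r. dir_deriv u g (x + \<xi> *\<^sub>R u + r *\<^sub>R v)", OF \<open>0 < \<epsilon>\<close> line[OF du]] by auto
  have "\<phi> \<epsilon> - \<phi> 0 = g (x + \<epsilon> *\<^sub>R u + \<epsilon> *\<^sub>R v) - g (x + \<epsilon> *\<^sub>R u) - g (x + \<epsilon> *\<^sub>R v) + g x"
    by (simp add: \<phi>_def)
  then show ?thesis using \<xi> \<eta> by metis
qed

text \<open>
  The second difference is symmetric in \<open>u\<close> and \<open>v\<close>. Divided by \<open>\<epsilon>\<^sup>2\<close>, it is therefore a
  value of both mixed derivatives, each taken somewhere in the parallelogram, which shrinks to \<open>x\<close> as \<open>\<epsilon>\<close>
  tends to \<open>0\<close>.
\<close>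

lemma dir_deriv_commute:
  fixes g :: "'a::euclidean_space \<Rightarrow> real"
  assumes g: "class_C 2 g"
  shows "dir_deriv v (dir_deriv u g) = dir_deriv u (dir_deriv v g)"
proof
  fix x
  let ?A = "dir_deriv v (dir_deriv u g)" and ?B = "dir_deriv u (dir_deriv v g)"
  have g1: "class_C (Suc (Suc 0)) g" using g by (simp only: numeral_2_eq_2)
  have cont: "isCont (dir_deriv a (dir_deriv b g)) x" for a b
    using class_C_continuous[OF class_C_dir_deriv[OF class_C_dir_deriv[OF g1]]]
    by (auto simp: continuous_on_eq_continuous_at)
  define \<epsilon> where "\<epsilon> n = inverse (real (Suc n))" for n
  have \<epsilon>: "0 < \<epsilon> n" "\<epsilon> \<longlonglongrightarrow> 0" for n
    using LIMSEQ_inverse_real_of_nat by (auto simp: \<epsilon>_def[abs_def])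
  have "\<exists>\<xi> \<eta>. 0 < \<xi> \<and> \<xi> < \<epsilon> n \<and> 0 < \<eta> \<and> \<eta> < \<epsilon> n \<and>
      g (x + \<epsilon> n *\<^sub>R u + \<epsilon> n *\<^sub>R v) - g (x + \<epsilon> n *\<^sub>R u) - g (x + \<epsilon> n *\<^sub>R v) + g x =
        \<epsilon> n * (\<epsilon> n * ?A (x + \<xi> *\<^sub>R u + \<eta> *\<^sub>R v))" for n
    by (rule second_difference_mean_value[OF g \<epsilon>(1)])
  then obtain a a' where a: "0 < a n" "a n < \<epsilon> n" "0 < a' n" "a' n < \<epsilon> n"
    "g (x + \<epsilon> n *\<^sub>R u + \<epsilon> n *\<^sub>R v) - g (x + \<epsilon> n *\<^sub>R u) - g (x + \<epsilon> n *\<^sub>R v) + g x =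
      \<epsilon> n * (\<epsilon> n * ?A (x + a n *\<^sub>R u + a' n *\<^sub>R v))" for n
    by metis
  have "\<exists>\<xi> \<eta>. 0 < \<xi> \<and> \<xi> < \<epsilon> n \<and> 0 < \<eta> \<and> \<eta> < \<epsilon> n \<and>
      g (x + \<epsilon> n *\<^sub>R v + \<epsilon> n *\<^sub>R u) - g (x + \<epsilon> n *\<^sub>R v) - g (x + \<epsilon> n *\<^sub>R u) + g x =
        \<epsilon> n * (\<epsilon> n * ?B (x + \<xi> *\<^sub>R v + \<eta> *\<^sub>R u))" for n
    by (rule second_difference_mean_value[OF g \<epsilon>(1)])
  then obtain b b' where b: "0 < b n" "b n < \<epsilon> n" "0 < b' n" "b' n < \<epsilon> n"
    "g (x + \<epsilon> n *\<^sub>R v + \<epsilon> n *\<^sub>R u) - g (x + \<epsilon> n *\<^sub>R v) - g (x + \<epsilon> n *\<^sub>R u) + g x =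
      \<epsilon> n * (\<epsilon> n * ?B (x + b n *\<^sub>R v + b' n *\<^sub>R u))" for n
    by metis
  have eq: "?A (x + a n *\<^sub>R u + a' n *\<^sub>R v) = ?B (x + b n *\<^sub>R v + b' n *\<^sub>R u)" for n
  proof -
    have "\<epsilon> n * (\<epsilon> n * ?A (x + a n *\<^sub>R u + a' n *\<^sub>R v)) =
        \<epsilon> n * (\<epsilon> n * ?B (x + b n *\<^sub>R v + b' n *\<^sub>R u))"
      using a(5)[of n] b(5)[of n] by (simp only: ac_simps)
    then show ?thesis using \<epsilon>(1)[of n] by simp
  qed
  have lim: "(\<lambda>n. x + c n *\<^sub>R w + c' n *\<^sub>R w') \<longlonglongrightarrow> x"
    if "\<And>n. 0 < c n" "\<And>n. c n < \<epsilon> n" "\<And>n. 0 < c' n" "\<And>n. c' n < \<epsilon> n" for c c' w w'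
  proof -
    have "c \<longlonglongrightarrow> 0" "c' \<longlonglongrightarrow> 0"
      using that
      by (auto intro!: tendsto_sandwich[OF _ _ tendsto_const \<epsilon>(2)] always_eventually less_imp_le)
    then have "(\<lambda>n. x + c n *\<^sub>R w + c' n *\<^sub>R w') \<longlonglongrightarrow> x + 0 *\<^sub>R w + 0 *\<^sub>R w'"
      by (intro tendsto_intros)
    then show ?thesis by simp
  qed
  have "(\<lambda>n. ?A (x + a n *\<^sub>R u + a' n *\<^sub>R v)) \<longlonglongrightarrow> ?A x"
    by (rule isCont_tendsto_compose[OF cont lim]) (use a in auto)
  moreover have "(\<lambda>n. ?B (x + b n *\<^sub>R v + b' n *\<^sub>R u)) \<longlonglongrightarrow> ?B x"
    by (rule isCont_tendsto_compose[OF cont lim]) (use b in auto)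
  ultimately show "?A x = ?B x"
    unfolding eq by (rule LIMSEQ_unique)
qed

lemma nderiv_dir_deriv:
  fixes g :: "'a::euclidean_space \<Rightarrow> real"
  assumes "class_C (Suc (length vs)) g"
  shows "nderiv (dir_deriv w g) vs = dir_deriv w (nderiv g vs)"
  using assms
proof (induction vs)
  case (Cons v vs)
  have "class_C (Suc (length vs)) g"
    using Cons.prems class_C_Suc_imp by simp
  moreover have "class_C 2 (nderiv g vs)"
    using Cons.prems by (intro class_C_nderiv) (simp add: numeral_2_eq_2)
  ultimately show ?case
    using Cons.IH dir_deriv_commute[of "nderiv g vs"] by (simp only: nderiv_Cons)
qed simp

text \<open>
  The first entry of \<open>vs\<close> occurs somewhere in \<open>ws\<close>, and commutes past the entries in front of it.
\<close>

lemma nderiv_perm_real: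
  fixes g :: "'a::euclidean_space \<Rightarrow> real"
  assumes "mset vs = mset ws" and "class_C (length vs) g"
  shows "nderiv g vs = nderiv g ws"
  using assms
proof (induction vs arbitrary: ws)
  case (Cons v vs)
  obtain ws1 ws2 where ws: "ws = ws1 @ v # ws2"
    using Cons.prems(1) by (metis list.set_intros(1) mset_eq_setD split_list)
  have len: "length vs = length (ws1 @ ws2)"
    using Cons.prems(1) ws by (metis add_mset_remove_trivial mset.simps(2) mset_append
        size_mset union_mset_add_mset_right)
  have "nderiv g vs = nderiv g (ws1 @ ws2)"
    using Cons.prems ws class_C_Suc_imp by (intro Cons.IH) auto
  moreover have "nderiv g ws = dir_deriv v (nderiv g (ws1 @ ws2))"
  proof -
    have "class_C (Suc (length ws1)) (nderiv g ws2)"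
      using Cons.prems(2) len by (intro class_C_nderiv) simp
    from nderiv_dir_deriv[OF this, of v] show ?thesis
      unfolding ws nderiv_append nderiv_Cons .
  qed
  ultimately show ?case by (simp only: nderiv_Cons)
qed simp

lemma nderiv_perm:
  fixes g :: "'a::euclidean_space \<Rightarrow> real^'k"
  assumes "mset vs = mset ws" and "class_C (length vs) g"
  shows "nderiv g vs y = nderiv g ws y"
proof (rule vec_eq_iff[THEN iffD2], rule allI)
  fix i
  have "class_C (length vs) (\<lambda>y. g y $ i)"
    using class_C_linear[OF bounded_linear_vec_nth assms(2)] .
  then have "nderiv (\<lambda>y. g y $ i) vs = nderiv (\<lambda>y. g y $ i) ws"
    by (rule nderiv_perm_real[OF assms(1)])
  then show "nderiv g vs y $ i = nderiv g ws y $ i"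
    using assms mset_eq_length[OF assms(1)]
    by (simp flip: nderiv_component)
qed

text \<open>
  Hence the arbitrary order in the definition of \<open>nderiv_mset\<close> does no harm.
\<close>

lemma nderiv_mset_eq:
  fixes g :: "'a::euclidean_space \<Rightarrow> real^'k"
  assumes "class_C (length vs) g"
  shows "nderiv_mset g (mset vs) y = nderiv g vs y"
proof -
  have "mset (SOME ws. mset ws = mset vs) = mset vs"
    by (rule someI[of _ vs]) simp
  then show ?thesis
    unfolding nderiv_mset_def using assms by (intro nderiv_perm[symmetric]) simp_all
qed

lemma nderiv_scale_directions:
  fixes g :: "'a::euclidean_space \<Rightarrow> 'b::euclidean_space" and c :: "'c \<Rightarrow> 'a"
  assumes "class_C (length hs) g"
  shows "nderiv g (map (\<lambda>h. r h *\<^sub>R c h) hs) y = prod_list (map r hs) *\<^sub>R nderiv g (map c hs) y"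
  using assms
proof (induction hs arbitrary: g y rule: rev_induct)
  case (snoc h hs)
  have g: "class_C (Suc (length hs)) g" using snoc.prems by simp
  have d: "dir_deriv (r h *\<^sub>R c h) g = (\<lambda>y. r h *\<^sub>R dir_deriv (c h) g y)"
    using dir_deriv_direction_sum[OF class_C_differentiable[OF g], of r c "{h}"] by simp
  have "class_C (length hs) (dir_deriv w g)" for w
    using class_C_dir_deriv[OF g] .
  then show ?case
    using snoc.IH class_C_linear[OF bounded_linear_scaleR_right]
    by (simp add: nderiv_snoc d nderiv_scaleR mult.commute)
qed simp


section \<open>Linear extension and grading\<close>

lemma lookup_scaleR [simp]:
  "Poly_Mapping.lookup (c *\<^sub>R x) k = c *\<^sub>R Poly_Mapping.lookup x k"
proof -
  have "finite {i. c *\<^sub>R Poly_Mapping.lookup x i \<noteq> 0}"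
    by (rule finite_subset[OF _ finite_keys[of x]]) (auto simp: in_keys_iff)
  then show ?thesis by (simp add: scaleR_poly_mapping_def)
qed

lemma scaleR_basis: "c *\<^sub>R basis k = Poly_Mapping.single k c"
  by (rule poly_mapping_eqI) (simp add: lookup_single when_def)

text \<open>This makes the forest algebra and its tensor square real algebras.\<close>

instance poly_mapping :: (comm_monoid_add, real_algebra_1) real_algebra_1
proof
  fix c :: real and x y :: "'a \<Rightarrow>\<^sub>0 'b"
  have fin: "finite {l. Poly_Mapping.lookup x l * Sum_any (\<lambda>q. Poly_Mapping.lookup y q when k = l + q) \<noteq> 0}" for k
    by (rule finite_subset[OF _ finite_keys[of x]]) (auto simp: in_keys_iff)
  have fin': "finite {q. (Poly_Mapping.lookup y q when P q) \<noteq> 0}" for P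
    by (rule finite_subset[OF _ finite_keys[of y]]) (auto simp: in_keys_iff)
  have scale: "c *\<^sub>R Sum_any g = Sum_any (\<lambda>a. c *\<^sub>R g a)" if "finite {a. g a \<noteq> 0}" for g :: "'c \<Rightarrow> 'b"
  proof (cases "c = 0")
    case False
    then have "{a. c *\<^sub>R g a \<noteq> 0} = {a. g a \<noteq> 0}" by auto
    then show ?thesis by (simp add: Sum_any.expand_set scaleR_right.sum)
  qed simp
  show "c *\<^sub>R x * y = c *\<^sub>R (x * y)"
    by (rule poly_mapping_eqI) (simp add: lookup_mult scale[OF fin])
  have when_scale: "c *\<^sub>R (b when P) = (c *\<^sub>R b when P)" for b :: 'b and P
    by (simp add: when_def)
  have "Sum_any (\<lambda>q. c *\<^sub>R Poly_Mapping.lookup y q when P q) =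
      c *\<^sub>R Sum_any (\<lambda>q. Poly_Mapping.lookup y q when P q)" for P
    using scale[OF fin'] by (simp add: when_scale)
  then show "x * c *\<^sub>R y = c *\<^sub>R (x * y)"
    by (intro poly_mapping_eqI) (simp add: lookup_mult scale[OF fin])
qed

lemma poly_mapping_eq_sum_basis:
  fixes x :: "'a \<Rightarrow>\<^sub>0 real"
  assumes "finite A" and "Poly_Mapping.keys x \<subseteq> A"
  shows "x = (\<Sum>k\<in>A. Poly_Mapping.lookup x k *\<^sub>R basis k)"
proof (rule poly_mapping_eqI)
  fix k
  have "(\<Sum>a\<in>A. Poly_Mapping.lookup x a * (1 when a = k)) = (\<Sum>a\<in>A. if a = k then Poly_Mapping.lookup x k else 0)"
    by (rule sum.cong) auto
  also have "\<dots> = Poly_Mapping.lookup x k"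
    using assms by (auto simp: in_keys_iff)
  finally show "Poly_Mapping.lookup x k =
      Poly_Mapping.lookup (\<Sum>k\<in>A. Poly_Mapping.lookup x k *\<^sub>R basis k) k"
    by (simp add: lookup_sum lookup_single)
qed

lemma linear_induct [case_names zero basis add scale]:
  fixes x :: "'a \<Rightarrow>\<^sub>0 real"
  assumes "P 0" and "\<And>k. P (basis k)" and "\<And>x y. P x \<Longrightarrow> P y \<Longrightarrow> P (x + y)"
    and "\<And>c x. P x \<Longrightarrow> P (c *\<^sub>R x)"
  shows "P x"
proof -
  have "P (\<Sum>k\<in>A. c k *\<^sub>R basis k)" for A c
    by (induction A rule: infinite_finite_induct) (auto intro: assms)
  then show ?thesis
    using poly_mapping_eq_sum_basis[OF finite_keys order.refl, of x] by metis
qed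

lemma lin_ext_eq_sum:
  assumes "finite A" and "Poly_Mapping.keys x \<subseteq> A"
  shows "lin_ext F x = (\<Sum>k\<in>A. Poly_Mapping.lookup x k *\<^sub>R F k)"
  unfolding lin_ext_def using assms by (intro sum.mono_neutral_left) (auto simp: in_keys_iff)

lemma linear_lin_ext: "linear (lin_ext F)"
proof (rule linearI)
  fix x y :: "'a \<Rightarrow>\<^sub>0 real"
  let ?A = "Poly_Mapping.keys x \<union> Poly_Mapping.keys y"
  have "lin_ext F (x + y) = (\<Sum>k\<in>?A. Poly_Mapping.lookup (x + y) k *\<^sub>R F k)"
    by (rule lin_ext_eq_sum) (use keys_add[of x y] in auto)
  also have "\<dots> = lin_ext F x + lin_ext F y"
    by (simp add: lin_ext_eq_sum[of ?A] lookup_add scaleR_left_distrib sum.distrib)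
  finally show "lin_ext F (x + y) = lin_ext F x + lin_ext F y" .
next
  fix c and x :: "'a \<Rightarrow>\<^sub>0 real"
  have "lin_ext F (c *\<^sub>R x) = (\<Sum>k\<in>Poly_Mapping.keys x. Poly_Mapping.lookup (c *\<^sub>R x) k *\<^sub>R F k)"
    by (rule lin_ext_eq_sum) (auto simp: in_keys_iff)
  then show "lin_ext F (c *\<^sub>R x) = c *\<^sub>R lin_ext F x"
    by (simp add: lin_ext_def scaleR_sum_right)
qed

lemma lin_ext_basis [simp]: "lin_ext F (basis k) = F k"
  by (simp add: lin_ext_def)

lemmas lin_ext_add = linear_add[OF linear_lin_ext]
  and lin_ext_scaleR = linear_scale[OF linear_lin_ext]
  and lin_ext_zero = linear_0[OF linear_lin_ext]

lemma lin_ext_mult: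
  fixes F :: "'a::comm_monoid_add \<Rightarrow> 'b::real_algebra"
  assumes "\<And>a b. F (a + b) = F a * F b"
  shows "lin_ext F (x * y) = lin_ext F x * lin_ext F y"
proof (induction x rule: linear_induct)
  case (basis k)
  show ?case
    by (induction y rule: linear_induct)
      (simp_all add: lin_ext_zero lin_ext_add lin_ext_scaleR distrib_left mult_single assms)
qed (simp_all add: lin_ext_zero lin_ext_add lin_ext_scaleR distrib_right)

text \<open>
  Forests and pairs of forests are both graded by their number of vertices. The functions at
  hand have finitely many derivatives, so their expansions make sense only below some degree, and identities are
  proved modulo terms of higher degree.
\<close>

locale grading =
  fixes deg :: "'m::comm_monoid_add \<Rightarrow> nat"
  assumes deg_add: "deg (a + b) = deg a + deg b"
begin

definition ord_ge :: "nat \<Rightarrow> ('m \<Rightarrow>\<^sub>0 real) \<Rightarrow> bool" where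
  "ord_ge n x \<longleftrightarrow> (\<forall>k. deg k < n \<longrightarrow> Poly_Mapping.lookup x k = 0)"

definition eq_below :: "nat \<Rightarrow> ('m \<Rightarrow>\<^sub>0 real) \<Rightarrow> ('m \<Rightarrow>\<^sub>0 real) \<Rightarrow> bool" where
  "eq_below n x y \<longleftrightarrow> (\<forall>k. deg k < n \<longrightarrow> Poly_Mapping.lookup x k = Poly_Mapping.lookup y k)"

lemma eq_below_iff: "eq_below n x y \<longleftrightarrow> ord_ge n (x - y)"
  by (simp add: eq_below_def ord_ge_def lookup_minus)

lemma ord_ge_iff: "ord_ge n x \<longleftrightarrow> eq_below n x 0"
  by (simp add: eq_below_def ord_ge_def)

lemma ord_ge_0 [simp]: "ord_ge 0 x" "ord_ge n 0"
  by (simp_all add: ord_ge_def)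

lemma ord_ge_mono: "ord_ge n x \<Longrightarrow> m \<le> n \<Longrightarrow> ord_ge m x"
  by (simp add: ord_ge_def)

lemma ord_ge_scaleR: "ord_ge n x \<Longrightarrow> ord_ge n (c *\<^sub>R x)"
  by (simp add: ord_ge_def)

lemma ord_ge_sum: "(\<And>i. i \<in> I \<Longrightarrow> ord_ge n (x i)) \<Longrightarrow> ord_ge n (\<Sum>i\<in>I. x i)"
  by (simp add: ord_ge_def lookup_sum)

lemma ord_ge_basis: "n \<le> deg k \<Longrightarrow> ord_ge n (basis k)"
  by (auto simp: ord_ge_def lookup_single when_def)

lemma ord_ge_mult:
  assumes "ord_ge m x" and "ord_ge n y"
  shows "ord_ge (m + n) (x * y)"
  unfolding ord_ge_def
proof (intro allI impI)
  fix k assume k: "deg k < m + n"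
  show "Poly_Mapping.lookup (x * y) k = 0"
  proof (rule ccontr)
    assume "Poly_Mapping.lookup (x * y) k \<noteq> 0"
    then obtain a b where "k = a + b" "a \<in> Poly_Mapping.keys x" "b \<in> Poly_Mapping.keys y"
      using keys_mult[of x y] by (auto simp: in_keys_iff)
    moreover from this have "m \<le> deg a" "n \<le> deg b"
      using assms by (auto simp: ord_ge_def in_keys_iff not_less[symmetric])
    ultimately show False using k by (simp add: deg_add)
  qed
qed

lemma eq_below_refl [simp]: "eq_below n x x"
  by (simp add: eq_below_def)

lemma eq_below_sym: "eq_below n x y \<Longrightarrow> eq_below n y x"
  by (simp add: eq_below_def)

lemma eq_below_trans [trans]: "eq_below n x y \<Longrightarrow> eq_below n y z \<Longrightarrow> eq_below n x z"
  by (simp add: eq_below_def)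

lemma eq_below_mono: "eq_below n x y \<Longrightarrow> m \<le> n \<Longrightarrow> eq_below m x y"
  by (simp add: eq_below_def)

lemma eq_below_add: "eq_below n x x' \<Longrightarrow> eq_below n y y' \<Longrightarrow> eq_below n (x + y) (x' + y')"
  by (simp add: eq_below_def lookup_add)

lemma eq_below_scaleR: "eq_below n x x' \<Longrightarrow> eq_below n (c *\<^sub>R x) (c *\<^sub>R x')"
  by (simp add: eq_below_def)

lemma eq_below_sum:
  "(\<And>i. i \<in> I \<Longrightarrow> eq_below n (x i) (y i)) \<Longrightarrow> eq_below n (\<Sum>i\<in>I. x i) (\<Sum>i\<in>I. y i)"
  by (simp add: eq_below_def lookup_sum)

lemma eq_below_mult_ord:
  assumes "eq_below n x y" and "ord_ge m z"
  shows "eq_below (n + m) (x * z) (y * z)"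
  using ord_ge_mult[of n "x - y" m z] assms by (simp add: eq_below_iff left_diff_distrib)

lemma eq_below_mult:
  assumes "eq_below n x x'" and "eq_below n y y'"
  shows "eq_below n (x * y) (x' * y')"
proof -
  have "eq_below n (x * y) (x' * y)" using eq_below_mult_ord[OF assms(1), of 0 y] by simp
  also have "eq_below n (x' * y) (x' * y')"
    using eq_below_mult_ord[OF assms(2), of 0 x'] by (simp add: mult.commute)
  finally show ?thesis .
qed

text \<open>
  A square of terms and its lower triangle differ by terms of degree above \<open>r\<close>. This turns the product of
  two truncated expansions into their Cauchy product.
\<close>

lemma eq_below_sum_triangle:
  assumes "\<And>i j. ord_ge (i + j) (f i j)"
  shows "eq_below (Suc r) (\<Sum>i\<le>r. \<Sum>j\<le>r. f i j) (\<Sum>n\<le>r. \<Sum>i\<le>n. f i (n - i))"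
proof -
  have "(\<Sum>i\<le>r. \<Sum>j\<le>r. f i j) = (\<Sum>(i, j)\<in>{..r} \<times> {..r}. f i j)"
    by (rule sum.cartesian_product)
  also have "\<dots> = (\<Sum>(i, j)\<in>{(i, j). i + j \<le> r}. f i j) +
      (\<Sum>(i, j)\<in>{..r} \<times> {..r} - {(i, j). i + j \<le> r}. f i j)"
    by (subst add.commute, rule sum.subset_diff) auto
  also have "eq_below (Suc r) \<dots> ((\<Sum>(i, j)\<in>{(i, j). i + j \<le> r}. f i j) + 0)"
    unfolding ord_ge_iff[symmetric]
    by (intro eq_below_add eq_below_refl)
      (auto simp: ord_ge_iff[symmetric] intro!: ord_ge_sum ord_ge_mono[OF assms])
  finally show ?thesis by (simp add: sum.triangle_reindex_eq)
qed

end


section \<open>Taylor sums with values in a graded algebra\<close>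

abbreviation partial :: "'k::finite \<Rightarrow> (real^'k \<Rightarrow> real) \<Rightarrow> real^'k \<Rightarrow> real" where
  "partial j \<equiv> dir_deriv (axis j 1)"

text \<open>
  \<open>shift U p K g\<close> is \<open>K\<close> applied to \<open>(\<Sum>\<^sub>j U\<^sub>j \<partial>\<^sub>j)\<^sup>p g\<close>, where the algebra elements \<open>U\<^sub>j\<close> are
  treated as constants. If \<open>K\<close> is evaluation at \<open>y\<close>, this is \<open>D\<^sup>pg(y)[U, \<dots>, U]\<close> for the algebra-valued
  direction \<open>U\<close>. Other \<open>K\<close> occur when one expansion is performed on top of another.
\<close>

primrec shift ::
    "('k::finite \<Rightarrow> 'a::comm_ring_1) \<Rightarrow> nat \<Rightarrow> ((real^'k \<Rightarrow> real) \<Rightarrow> 'a) \<Rightarrow> (real^'k \<Rightarrow> real) \<Rightarrow> 'a" where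
  "shift U 0 K g = K g"
| "shift U (Suc p) K g = (\<Sum>j\<in>UNIV. U j * shift U p K (partial j g))"

definition eval_at :: "real^'k \<Rightarrow> (real^'k \<Rightarrow> real) \<Rightarrow> 'a::real_algebra_1" where
  "eval_at y g = g y *\<^sub>R 1"

text \<open>
  The Taylor polynomial of order \<open>M\<close> for \<open>g(y + U)\<close>.
\<close>

definition taylor ::
    "nat \<Rightarrow> real^'k::finite \<Rightarrow> ('k \<Rightarrow> 'm::comm_monoid_add \<Rightarrow>\<^sub>0 real) \<Rightarrow> (real^'k \<Rightarrow> real) \<Rightarrow> ('m \<Rightarrow>\<^sub>0 real)" where
  "taylor M y U g = (\<Sum>p\<le>M. (1 / fact p) *\<^sub>R shift U p (eval_at y) g)"

lemma shift_sum_scaleR: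
  fixes U :: "'k::finite \<Rightarrow> 'm::comm_monoid_add \<Rightarrow>\<^sub>0 real"
  shows "shift U q (\<lambda>g. \<Sum>p\<in>I. c p *\<^sub>R K p g) g = (\<Sum>p\<in>I. c p *\<^sub>R shift U q (K p) g)"
proof (induction q arbitrary: g)
  case (Suc q)
  have "shift U (Suc q) (\<lambda>g. \<Sum>p\<in>I. c p *\<^sub>R K p g) g =
      (\<Sum>j\<in>UNIV. \<Sum>p\<in>I. c p *\<^sub>R (U j * shift U q (K p) (partial j g)))"
    by (simp add: Suc.IH sum_distrib_left)
  then show ?case
    by (simp add: scaleR_sum_right) (rule sum.swap)
qed simp

lemma shift_hom:
  fixes \<phi> :: "'a::comm_ring_1 \<Rightarrow> 'b::comm_ring_1" and U :: "'k::finite \<Rightarrow> 'a"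
  assumes "\<And>x y. \<phi> (x + y) = \<phi> x + \<phi> y" and "\<phi> 0 = 0" and "\<And>x y. \<phi> (x * y) = \<phi> x * \<phi> y"
  shows "\<phi> (shift U p K g) = shift (\<lambda>j. \<phi> (U j)) p (\<lambda>g. \<phi> (K g)) g"
proof (induction p arbitrary: g)
  case (Suc p)
  have "\<phi> (\<Sum>j\<in>A. f j) = (\<Sum>j\<in>A. \<phi> (f j))" for f :: "'k \<Rightarrow> 'a" and A
    by (induction A rule: infinite_finite_induct) (simp_all add: assms)
  then show ?case by (simp add: assms Suc.IH)
qed simp

text \<open>
  Derivatives of \<open>g\<close> are scalars, so an algebra morphism acts on the increment alone.
\<close>

lemma taylor_hom:
  assumes "linear \<phi>" and "\<And>x y. \<phi> (x * y) = \<phi> x * \<phi> y" and "\<phi> 1 = 1"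
  shows "\<phi> (taylor M y U g) = taylor M y (\<lambda>j. \<phi> (U j)) g"
  using assms by (simp add: taylor_def linear_sum linear_scale linear_add linear_0 shift_hom eval_at_def[abs_def])

lemma jet_add:
  assumes "class_C p g" and "class_C p h"
  shows "shift U p (eval_at y) (\<lambda>z. g z + h z) =
    (shift U p (eval_at y) g + shift U p (eval_at y) h :: 'm::comm_monoid_add \<Rightarrow>\<^sub>0 real)"
  using assms
proof (induction p arbitrary: g h)
  case (Suc p)
  have d: "g differentiable (at z)" "h differentiable (at z)" for z
    using Suc.prems class_C_differentiable by auto
  show ?case
    using class_C_dir_deriv[OF Suc.prems(1)] class_C_dir_deriv[OF Suc.prems(2)]
    by (simp add: dir_deriv_add d Suc.IH distrib_left sum.distrib)
qed (simp add: eval_at_def scaleR_left_distrib)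

lemma jet_const: "shift U p (eval_at y) (\<lambda>z. c) = (if p = 0 then c *\<^sub>R 1 else 0 :: 'm::comm_monoid_add \<Rightarrow>\<^sub>0 real)"
proof (cases p)
  case (Suc q)
  have "shift U n (eval_at y) (\<lambda>z. 0) = (0 :: 'm \<Rightarrow>\<^sub>0 real)" for n
    by (induction n) (simp_all add: eval_at_def)
  then show ?thesis using Suc by simp
qed (simp add: eval_at_def)

lemma jet_sum:
  assumes "\<And>i. i \<in> I \<Longrightarrow> class_C p (g i)"
  shows "shift U p (eval_at y) (\<lambda>z. \<Sum>i\<in>I. g i z) =
    (\<Sum>i\<in>I. shift U p (eval_at y) (g i) :: 'm::comm_monoid_add \<Rightarrow>\<^sub>0 real)"
  using assms
  by (induction I rule: infinite_finite_induct) (simp_all add: jet_const jet_add class_C_sum)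

text \<open>
  Pascal's rule, in the form needed by the inductive proofs of both the Leibniz rule and the binomial rule for a
  sum of two increments.
\<close>

lemma binomial_step:
  fixes f :: "nat \<Rightarrow> nat \<Rightarrow> 'a::real_vector"
  shows "(\<Sum>q\<le>p. real (p choose q) *\<^sub>R (f (Suc q) (p - q) + f q (Suc (p - q)))) =
    (\<Sum>q\<le>Suc p. real (Suc p choose q) *\<^sub>R f q (Suc p - q))"
proof -
  have "(\<Sum>q\<le>Suc p. real (Suc p choose q) *\<^sub>R f q (Suc p - q)) =
      f 0 (Suc p) + (\<Sum>q\<le>p. real (Suc p choose Suc q) *\<^sub>R f (Suc q) (p - q))"
    by (subst sum.atMost_Suc_shift) simp
  also have "\<dots> = f 0 (Suc p) + (\<Sum>q\<le>p. real (p choose Suc q) *\<^sub>R f (Suc q) (p - q)) +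
      (\<Sum>q\<le>p. real (p choose q) *\<^sub>R f (Suc q) (p - q))"
    by (simp add: scaleR_left_distrib sum.distrib)
  also have "f 0 (Suc p) + (\<Sum>q\<le>p. real (p choose Suc q) *\<^sub>R f (Suc q) (p - q)) =
      (\<Sum>q\<le>Suc p. real (p choose q) *\<^sub>R f q (Suc p - q))"
    by (subst sum.atMost_Suc_shift) simp
  also have "\<dots> = (\<Sum>q\<le>p. real (p choose q) *\<^sub>R f q (Suc (p - q)))"
    by (simp add: Suc_diff_le)
  finally show ?thesis by (simp add: scaleR_right_distrib sum.distrib)
qed

text \<open>
  Leibniz rule. Summation over all directions at once absorbs the sum over subsets of directions
  into binomial coefficients.
\<close>

lemma jet_mult:
  fixes U :: "'k::finite \<Rightarrow> 'm::comm_monoid_add \<Rightarrow>\<^sub>0 real"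
  assumes "class_C p g" and "class_C p h"
  shows "shift U p (eval_at y) (\<lambda>z. g z * h z) =
    (\<Sum>q\<le>p. real (p choose q) *\<^sub>R (shift U q (eval_at y) g * shift U (p - q) (eval_at y) h))"
  using assms
proof (induction p arbitrary: g h)
  case (Suc p)
  let ?J = "\<lambda>p. shift U p (eval_at y)"
  have d: "g differentiable (at z)" "h differentiable (at z)" for z
    using Suc.prems class_C_differentiable by auto
  have C: "class_C p g" "class_C p h" "class_C p (partial j g)" "class_C p (partial j h)" for j
    using Suc.prems class_C_Suc_imp class_C_dir_deriv by auto
  have "?J (Suc p) (\<lambda>z. g z * h z) =
      (\<Sum>j\<in>UNIV. U j * (\<Sum>q\<le>p. real (p choose q) *\<^sub>R
        (?J q (partial j g) * ?J (p - q) h + ?J q g * ?J (p - q) (partial j h))))"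
    by (simp add: dir_deriv_mult d jet_add C class_C_mult Suc.IH sum.distrib scaleR_right_distrib)
  also have "\<dots> = (\<Sum>q\<le>p. real (p choose q) *\<^sub>R
      (?J (Suc q) g * ?J (p - q) h + ?J q g * ?J (Suc (p - q)) h))"
    unfolding sum_distrib_left
    by (subst sum.swap)
      (simp add: scaleR_sum_right sum_distrib_left sum_distrib_right sum.distrib algebra_simps)
  finally show ?case by (simp only: binomial_step[of p "\<lambda>q r. ?J q g * ?J r h"])
qed (simp add: eval_at_def)

text \<open>
  Moving a derivative along \<open>U\<close> past those along \<open>V\<close> is the step where second derivatives have to be
  symmetric.
\<close>

lemma shift_partial_commute:
  assumes "class_C (Suc (q + p)) g"
  shows "(\<Sum>j\<in>UNIV. U j * shift V q (shift U p K) (partial j g)) = shift V q (shift U (Suc p) K) g"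
  using assms
proof (induction q arbitrary: g)
  case (Suc q)
  have "class_C 2 g" using Suc.prems by (rule class_C_mono) simp
  then have comm: "partial i (partial j g) = partial j (partial i g)" for i j
    by (rule dir_deriv_commute)
  have "class_C (Suc (q + p)) (partial i g)" for i
    using Suc.prems class_C_dir_deriv by simp
  note IH = Suc.IH[OF this]
  have "(\<Sum>j\<in>UNIV. U j * shift V (Suc q) (shift U p K) (partial j g)) =
      (\<Sum>i\<in>UNIV. V i * (\<Sum>j\<in>UNIV. U j * shift V q (shift U p K) (partial j (partial i g))))"
    unfolding shift.simps(2)[of V q] sum_distrib_left
    by (subst sum.swap) (intro sum.cong refl, simp only: comm mult.left_commute)
  also have "\<dots> = shift V (Suc q) (shift U (Suc p) K) g"
    unfolding IH by simp
  finally show ?case .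
qed simp

text \<open>
  Binomial rule: with commuting derivatives, those along \<open>V\<close> can be performed first.
\<close>

lemma shift_add_directions:
  fixes U V :: "'k::finite \<Rightarrow> 'm::comm_monoid_add \<Rightarrow>\<^sub>0 real"
  assumes "class_C p g"
  shows "shift (\<lambda>j. U j + V j) p K g =
    (\<Sum>q\<le>p. real (p choose q) *\<^sub>R shift V q (shift U (p - q) K) g)"
  using assms
proof (induction p arbitrary: g)
  case (Suc p)
  have "class_C p (partial j g)" for j
    using Suc.prems class_C_dir_deriv by blast
  then have "shift (\<lambda>j. U j + V j) (Suc p) K g =
      (\<Sum>j\<in>UNIV. \<Sum>q\<le>p. (U j + V j) * (real (p choose q) *\<^sub>R shift V q (shift U (p - q) K) (partial j g)))"
    by (simp add: Suc.IH sum_distrib_left)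
  also have "\<dots> = (\<Sum>q\<le>p. real (p choose q) *\<^sub>R
      (shift V (Suc q) (shift U (p - q) K) g +
        (\<Sum>j\<in>UNIV. U j * shift V q (shift U (p - q) K) (partial j g))))"
    by (subst sum.swap) (simp add: scaleR_sum_right sum.distrib algebra_simps)
  also have "\<dots> = (\<Sum>q\<le>p. real (p choose q) *\<^sub>R
      (shift V (Suc q) (shift U (p - q) K) g + shift V q (shift U (Suc (p - q)) K) g))"
    using Suc.prems by (intro sum.cong refl) (simp add: shift_partial_commute del: shift.simps)
  finally show ?case
    by (simp only: binomial_step[of p "\<lambda>q r. shift V q (shift U r K) g"])
qed simp

context grading
begin

lemma ord_ge_shift:
  assumes "\<And>j. ord_ge 1 (U j)" and "\<And>g. ord_ge m (K g)"
  shows "ord_ge (q + m) (shift U q K g)"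
proof (induction q arbitrary: g)
  case (Suc q)
  have "ord_ge (1 + (q + m)) (U j * shift U q K (partial j g))" for j
    using assms(1) Suc.IH by (intro ord_ge_mult)
  then show ?case by (auto intro: ord_ge_sum)
qed (simp add: assms)

lemma ord_ge_jet: "(\<And>j. ord_ge 1 (U j)) \<Longrightarrow> ord_ge p (shift U p (eval_at y) g)"
  using ord_ge_shift[of U 0 "eval_at y" p g] by simp

lemma eq_below_shift:
  assumes "\<And>j. eq_below n (U j) (V j)" and "\<And>g. eq_below n (K g) (K' g)"
  shows "eq_below n (shift U q K g) (shift V q K' g)"
  using assms by (induction q arbitrary: g) (auto intro!: eq_below_sum eq_below_mult)

lemma eq_below_taylor:
  "(\<And>j. eq_below n (U j) (V j)) \<Longrightarrow> eq_below n (taylor M y U g) (taylor M y V g)"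
  unfolding taylor_def by (intro eq_below_sum eq_below_scaleR eq_below_shift) auto

lemma lin_ext_eq_below:
  assumes "\<And>k. ord_ge (deg' k + m) (F k)"
    and "\<And>k. deg' k < n \<Longrightarrow> Poly_Mapping.lookup x k = Poly_Mapping.lookup y k"
  shows "eq_below (n + m) (lin_ext F x) (lin_ext F y)"
proof -
  have "n \<le> deg' k" if "k \<in> Poly_Mapping.keys (x - y)" for k
    using assms(2)[of k] that by (cases "deg' k < n") (auto simp: in_keys_iff lookup_minus)
  then have "ord_ge (n + m) (F k)" if "k \<in> Poly_Mapping.keys (x - y)" for k
    using that by (intro ord_ge_mono[OF assms(1)[of k]]) auto
  then have "ord_ge (n + m) (lin_ext F (x - y))"
    unfolding lin_ext_def by (intro ord_ge_sum ord_ge_scaleR)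
  then show ?thesis
    by (simp add: eq_below_iff linear_diff[OF linear_lin_ext])
qed

text \<open>
  The increment has no constant term, so its \<open>p\<close>-th power has degree at least \<open>p\<close>: only derivatives of order at
  most \<open>r\<close> are seen in degrees at most \<open>r\<close>. This lets functions of class \<open>C\<^sup>r\<close> be expanded to a
  higher order \<open>M\<close>, where the additional derivatives are unspecified.
\<close>

lemma taylor_truncate:
  assumes "\<And>j. ord_ge 1 (U j)" and "r \<le> M"
  shows "eq_below (Suc r) (taylor M y U g) (taylor r y U g)"
proof -
  have "taylor M y U g - taylor r y U g =
      (\<Sum>p\<in>{..M} - {..r}. (1 / fact p) *\<^sub>R shift U p (eval_at y) g)"
    unfolding taylor_def using assms(2) by (subst sum_diff) auto
  then show ?thesis
    unfolding eq_below_iff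
    by (auto intro!: ord_ge_sum ord_ge_scaleR ord_ge_mono[OF ord_ge_jet[OF assms(1)]])
qed

lemma taylor_sum:
  fixes g :: "'i \<Rightarrow> real^'k::finite \<Rightarrow> real"
  assumes "\<And>j. ord_ge 1 (U j)" and "r \<le> M" and "\<And>i. i \<in> I \<Longrightarrow> class_C r (g i)"
  shows "eq_below (Suc r) (taylor M y U (\<lambda>z. \<Sum>i\<in>I. g i z)) (\<Sum>i\<in>I. taylor M y U (g i))"
proof -
  have tr: "eq_below (Suc r) (taylor M y U f) (taylor r y U f)" for f
    using taylor_truncate[OF assms(1,2)] .
  have "taylor r y U (\<lambda>z. \<Sum>i\<in>I. g i z) =
      (\<Sum>p\<le>r. (1 / fact p) *\<^sub>R (\<Sum>i\<in>I. shift U p (eval_at y) (g i)))"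
    unfolding taylor_def using class_C_mono[OF assms(3)] by (intro sum.cong refl) (simp add: jet_sum)
  also have "\<dots> = (\<Sum>i\<in>I. taylor r y U (g i))"
    unfolding taylor_def scaleR_sum_right by (rule sum.swap)
  finally have "taylor r y U (\<lambda>z. \<Sum>i\<in>I. g i z) = (\<Sum>i\<in>I. taylor r y U (g i))" .
  with tr[where f = "\<lambda>z. \<Sum>i\<in>I. g i z"] have "eq_below (Suc r) (taylor M y U (\<lambda>z. \<Sum>i\<in>I. g i z)) (\<Sum>i\<in>I. taylor r y U (g i))"
    by simp
  also have "eq_below (Suc r) (\<Sum>i\<in>I. taylor r y U (g i)) (\<Sum>i\<in>I. taylor M y U (g i))"
    by (intro eq_below_sum eq_below_sym[OF tr])
  finally show ?thesis .
qed

text \<open>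
  After division by \<open>p!\<close>, the sum in the Leibniz rule is a Cauchy product.
\<close>

lemma taylor_mult:
  assumes U: "\<And>j. ord_ge 1 (U j)" and "r \<le> M" and "class_C r g" and "class_C r h"
  shows "eq_below (Suc r) (taylor M y U (\<lambda>z. g z * h z)) (taylor M y U g * taylor M y U h)"
proof -
  note tr = taylor_truncate[OF U assms(2)]
  let ?J = "\<lambda>p. shift U p (eval_at y)"
  have "eq_below (Suc r) (taylor M y U (\<lambda>z. g z * h z)) (taylor r y U (\<lambda>z. g z * h z))"
    by (rule tr)
  also have "taylor r y U (\<lambda>z. g z * h z) =
      (\<Sum>n\<le>r. \<Sum>q\<le>n. ((1 / fact q) *\<^sub>R ?J q g) * ((1 / fact (n - q)) *\<^sub>R ?J (n - q) h))"
    unfolding taylor_def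
  proof (rule sum.cong[OF refl])
    fix n assume "n \<in> {..r}"
    then have "class_C n g" "class_C n h" using assms(3,4) class_C_mono by auto
    then show "(1 / fact n) *\<^sub>R ?J n (\<lambda>z. g z * h z) =
        (\<Sum>q\<le>n. ((1 / fact q) *\<^sub>R ?J q g) * ((1 / fact (n - q)) *\<^sub>R ?J (n - q) h))"
      by (simp add: jet_mult scaleR_sum_right binomial_fact field_simps)
  qed
  also have "eq_below (Suc r) \<dots> (\<Sum>q\<le>r. \<Sum>p\<le>r. ((1 / fact q) *\<^sub>R ?J q g) * ((1 / fact p) *\<^sub>R ?J p h))"
    by (intro eq_below_sym[OF eq_below_sum_triangle] ord_ge_mult ord_ge_scaleR ord_ge_jet U)
  also have "\<dots> = taylor r y U g * taylor r y U h"
    by (simp add: taylor_def sum_product)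
  also have "eq_below (Suc r) \<dots> (taylor M y U g * taylor M y U h)"
    by (intro eq_below_mult eq_below_sym[OF tr])
  finally show ?thesis .
qed

text \<open>
  Taylor's formula for \<open>g((y + U) + V)\<close>: the derivatives of \<open>g\<close> are expanded with increment \<open>U\<close> and
  inserted into the expansion with increment \<open>V\<close>.
\<close>

lemma taylor_add_directions:
  assumes U: "\<And>j. ord_ge 1 (U j)" and V: "\<And>j. ord_ge 1 (V j)" and g: "class_C M g"
  shows "eq_below (Suc M) (taylor M y (\<lambda>j. U j + V j) g)
    (\<Sum>q\<le>M. (1 / fact q) *\<^sub>R shift V q (taylor M y U) g)"
proof -
  let ?f = "\<lambda>q p. (1 / (fact q * fact p)) *\<^sub>R shift V q (shift U p (eval_at y)) g"
  have "taylor M y (\<lambda>j. U j + V j) g = (\<Sum>n\<le>M. \<Sum>q\<le>n. ?f q (n - q))"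
    unfolding taylor_def
  proof (rule sum.cong[OF refl])
    fix n assume "n \<in> {..M}"
    then have "class_C n g" using g class_C_mono by auto
    then show "(1 / fact n) *\<^sub>R shift (\<lambda>j. U j + V j) n (eval_at y) g = (\<Sum>q\<le>n. ?f q (n - q))"
      by (simp add: shift_add_directions scaleR_sum_right binomial_fact field_simps)
  qed
  moreover have "(\<Sum>q\<le>M. (1 / fact q) *\<^sub>R shift V q (taylor M y U) g) = (\<Sum>q\<le>M. \<Sum>p\<le>M. ?f q p)"
    unfolding taylor_def[abs_def] shift_sum_scaleR by (simp add: scaleR_sum_right)
  moreover have "eq_below (Suc M) (\<Sum>q\<le>M. \<Sum>p\<le>M. ?f q p) (\<Sum>n\<le>M. \<Sum>q\<le>n. ?f q (n - q))"
    by (intro eq_below_sum_triangle ord_ge_scaleR ord_ge_shift ord_ge_jet U V)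
  ultimately show ?thesis using eq_below_sym by simp
qed

end


section \<open>The forest algebra and its coproduct\<close>

lemma fsize_empty [simp]: "fsize {#} = 0"
  and fsize_add: "fsize (f + g) = fsize f + fsize g"
  and fsize_single [simp]: "fsize {#h#} = vertices h"
  by (simp_all add: fsize_def)

fun tensor_size :: "'d forest \<times> 'd forest \<Rightarrow> nat" where
  "tensor_size (a, b) = fsize a + fsize b"

interpretation forest: grading "fsize :: 'd forest \<Rightarrow> nat"
  by unfold_locales (rule fsize_add)

interpretation tensor: grading "tensor_size :: 'd forest \<times> 'd forest \<Rightarrow> nat"
  by unfold_locales (auto simp: fsize_add)

lemma lookup_proj_le:
  "Poly_Mapping.lookup (proj_le n x) f = (if fsize f \<le> n then Poly_Mapping.lookup x f else 0)"
proof -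
  have "Poly_Mapping.lookup (proj_le n x) f =
      (\<Sum>k\<in>Poly_Mapping.keys x. if k = f then (if fsize f \<le> n then Poly_Mapping.lookup x f else 0) else 0)"
    unfolding proj_le_def lin_ext_def lookup_sum
    by (intro sum.cong refl) (auto simp: lookup_single when_def)
  then show ?thesis by (auto simp: in_keys_iff)
qed

lemma linear_coprod: "linear coprod"
  unfolding coprod_def by (rule linear_lin_ext)

lemma coprod_forest_add: "coprod_forest (f + g) = coprod_forest f * coprod_forest g"
  by (simp add: coprod_forest_def)

lemma coprod_mult: "coprod (x * y) = coprod x * coprod y"
  unfolding coprod_def by (rule lin_ext_mult) (rule coprod_forest_add)

lemma coprod_basis [simp]: "coprod (basis f) = coprod_forest f"
  by (simp add: coprod_def)

lemma coprod_forest_single: "coprod_forest {#h#} = coprod_tree h"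
  by (simp add: coprod_forest_def)

lemma coprod_one: "coprod 1 = 1"
  using coprod_basis[of "{#}"] by (simp add: coprod_forest_def)

text \<open>The algebra morphism \<open>x \<mapsto> x \<otimes> 1\<close>.\<close>

definition tensor_left :: "'d forest_alg \<Rightarrow> 'd forest_tensor" where
  "tensor_left = lin_ext (\<lambda>a. basis (a, {#}))"

lemma linear_tensor_left: "linear tensor_left"
  unfolding tensor_left_def by (rule linear_lin_ext)

lemma tensor_left_mult: "tensor_left (x * y) = tensor_left x * tensor_left y"
  unfolding tensor_left_def by (rule lin_ext_mult) (simp add: mult_single)

lemma tensor_left_basis [simp]: "tensor_left (basis a) = basis (a, {#})"
  by (simp add: tensor_left_def)

lemma tensor_left_one: "tensor_left 1 = 1"
  using tensor_left_basis[of "{#}"] by (simp flip: zero_prod_def)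

lemma lookup_tensor_left_mult:
  "Poly_Mapping.lookup (tensor_left x * basis ({#}, f)) (a, b) =
    (if b = f then Poly_Mapping.lookup x a else 0)"
proof (induction x rule: linear_induct)
  case (basis k)
  then show ?case by (auto simp: mult_single lookup_single when_def)
qed (auto simp: linear_0[OF linear_tensor_left] linear_add[OF linear_tensor_left]
    linear_scale[OF linear_tensor_left] lookup_add distrib_right)

lemma eq_below_tensor_left:
  "forest.eq_below n x y \<Longrightarrow> tensor.eq_below n (tensor_left x) (tensor_left y)"
  using tensor.lin_ext_eq_below[of fsize 0 "\<lambda>a. basis (a, {#})" n x y]
  by (simp add: forest.eq_below_def tensor_left_def tensor.ord_ge_basis)

lemma linear_graft: "linear (id_tensor_graft \<mu>)"
  unfolding id_tensor_graft_def by (rule linear_lin_ext)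

lemma ord_ge_graft_basis:
  "tensor.ord_ge (tensor_size k + 1) (case k of (a, b) \<Rightarrow> basis (a, {#Node \<mu> b#}))"
  by (cases k) (auto intro!: tensor.ord_ge_basis simp: vertices_Node simp del: vertices.simps)

lemma eq_below_graft:
  assumes "tensor.eq_below n x y"
  shows "tensor.eq_below (Suc n) (id_tensor_graft \<mu> x) (id_tensor_graft \<mu> y)"
proof -
  have "tensor.eq_below (n + 1) (id_tensor_graft \<mu> x) (id_tensor_graft \<mu> y)"
    unfolding id_tensor_graft_def
    by (rule tensor.lin_ext_eq_below[of tensor_size 1, OF ord_ge_graft_basis])
      (use assms in \<open>simp add: tensor.eq_below_def del: split_paired_All\<close>)
  then show ?thesis by simp
qed

lemma id_tensor_graft_basis: "id_tensor_graft \<mu> (basis (a, b)) = basis (a, {#Node \<mu> b#})"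
  by (simp add: id_tensor_graft_def)

lemma graft_tensor_left:
  "id_tensor_graft \<mu> (tensor_left x * basis ({#}, f)) = tensor_left x * basis ({#}, {#Node \<mu> f#})"
  by (induction x rule: linear_induct)
    (simp_all add: linear_0[OF linear_tensor_left] linear_add[OF linear_tensor_left]
      linear_scale[OF linear_tensor_left] linear_0[OF linear_graft] linear_add[OF linear_graft]
      linear_scale[OF linear_graft] distrib_right mult_single id_tensor_graft_basis)

text \<open>
  Cutting a forest neither creates nor destroys vertices.
\<close>

lemma coprod_forest_homogeneous:
  "k \<in> Poly_Mapping.keys (coprod_forest f) \<Longrightarrow> tensor_size k = fsize f"
proof -
  have step: "\<forall>k\<in>Poly_Mapping.keys (coprod_forest f). tensor_size k = fsize f"
    if "\<And>h. h \<in># f \<Longrightarrow> \<forall>k\<in>Poly_Mapping.keys (coprod_tree h). tensor_size k = vertices h"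
    for f :: "'d forest"
    using that
  proof (induction f)
    case empty
    then show ?case by (auto simp: coprod_forest_def zero_prod_def)
  next
    case (add h f)
    show ?case
    proof
      fix k
      assume "k \<in> Poly_Mapping.keys (coprod_forest (add_mset h f))"
      then have "k \<in> Poly_Mapping.keys (coprod_tree h * coprod_forest f)"
        by (simp add: coprod_forest_def)
      then obtain a b where "k = a + b" "a \<in> Poly_Mapping.keys (coprod_tree h)"
        "b \<in> Poly_Mapping.keys (coprod_forest f)"
        using keys_mult by blast
      moreover from this have "tensor_size a = vertices h" "tensor_size b = fsize f"
        using add by auto
      ultimately show "tensor_size k = fsize (add_mset h f)"
        by (simp add: tensor.deg_add fsize_def)
    qed
  qed
  have tree: "\<forall>k\<in>Poly_Mapping.keys (coprod_tree h). tensor_size k = vertices h" for h :: "'d rtree"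
  proof (induction h)
    case (Node \<mu> f)
    have f: "\<forall>k\<in>Poly_Mapping.keys (coprod_forest f). tensor_size k = fsize f"
      by (rule step) (rule Node)
    show ?case
    proof
      fix k
      assume "k \<in> Poly_Mapping.keys (coprod_tree (Node \<mu> f))"
      then consider "k = ({#Node \<mu> f#}, {#})" |
          "k \<in> Poly_Mapping.keys (id_tensor_graft \<mu> (coprod_forest f))"
        using subsetD[OF keys_add, of k "basis ({#Node \<mu> f#}, {#})" "id_tensor_graft \<mu> (coprod_forest f)"]
        unfolding coprod_tree_Node by auto
      then show "tensor_size k = vertices (Node \<mu> f)"
      proof cases
        case 2
        then obtain l where l: "l \<in> Poly_Mapping.keys (coprod_forest f)"
          and "k \<in> Poly_Mapping.keys (Poly_Mapping.lookup (coprod_forest f) l *\<^sub>R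
            (case l of (a, b) \<Rightarrow> basis (a, {#Node \<mu> b#})) :: 'd forest_tensor)"
          using subsetD[OF keys_sum, of k "\<lambda>l. Poly_Mapping.lookup (coprod_forest f) l *\<^sub>R
              (case l of (a, b) \<Rightarrow> basis (a, {#Node \<mu> b#}))" "Poly_Mapping.keys (coprod_forest f)"]
          unfolding id_tensor_graft_def lin_ext_def by blast
        then have "k = (fst l, {#Node \<mu> (snd l)#})"
          by (cases l) (auto simp: in_keys_iff lookup_single when_def split: if_splits)
        then show ?thesis
          using f l by (cases l) (auto simp: vertices_Node simp del: vertices.simps)
      qed (simp del: vertices.simps)
    qed
  qed
  show "k \<in> Poly_Mapping.keys (coprod_forest f) \<Longrightarrow> tensor_size k = fsize f"
    using step tree by blast
qed

lemma eq_below_coprod: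
  assumes "forest.eq_below n x y"
  shows "tensor.eq_below n (coprod x) (coprod y)"
proof -
  have "tensor.ord_ge (fsize f + 0) (coprod_forest f)" for f :: "'a forest"
    unfolding tensor.ord_ge_def
    using coprod_forest_homogeneous[of _ f] by (metis add_0_right in_keys_iff less_irrefl)
  from tensor.lin_ext_eq_below[of fsize 0 coprod_forest, OF this, of n x y] show ?thesis
    using assms by (simp add: forest.eq_below_def coprod_def)
qed


section \<open>Taylor sums as sums over forests\<close>

lemma sum_lists_snoc:
  fixes F :: "'a list \<Rightarrow> 'b::comm_monoid_add"
  shows "(\<Sum>hs | length hs = Suc p \<and> set hs \<subseteq> I. F hs) =
    (\<Sum>hs | length hs = p \<and> set hs \<subseteq> I. \<Sum>h\<in>I. F (hs @ [h]))"
proof -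
  have "{hs. length hs = Suc p \<and> set hs \<subseteq> I} =
      (\<lambda>(hs, h). hs @ [h]) ` ({hs. length hs = p \<and> set hs \<subseteq> I} \<times> I)" (is "?A = ?B")
  proof
    show "?A \<subseteq> ?B"
    proof
      fix hs assume hs: "hs \<in> ?A"
      then obtain ks h where "hs = ks @ [h]" by (cases hs rule: rev_cases) auto
      with hs show "hs \<in> ?B"
        by (intro image_eqI[of _ _ "(ks, h)"]) auto
    qed
  qed auto
  moreover have "inj_on (\<lambda>(hs, h). hs @ [h]) X" for X :: "('a list \<times> 'a) set"
    by (auto intro: inj_onI)
  ultimately show ?thesis
    by (simp add: sum.reindex sum.cartesian_product case_prod_unfold)
qed

lemma vec_eq_sum_axis: "v = (\<Sum>j\<in>UNIV. v $ j *\<^sub>R axis j (1 :: real))"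
  by (simp add: vec_eq_iff axis_def if_distrib[of "\<lambda>x. _ * x"] cong: if_cong)

lemma dir_deriv_eq_sum_partial:
  assumes "\<And>y. g differentiable (at y)"
  shows "dir_deriv v g = (\<lambda>y. \<Sum>j\<in>UNIV. v $ j *\<^sub>R partial j g y)"
  using dir_deriv_direction_sum[OF assms, of "\<lambda>j. v $ j" "\<lambda>j. axis j 1" UNIV] vec_eq_sum_axis[of v]
  by simp

text \<open>
  Conversion between the two forms of \<open>D\<^sup>pg(y)[W, \<dots>, W]\<close> for \<open>W = \<Sum>\<^sub>h c\<^sub>h x\<^sub>h\<close>: multilinear expansion over
  the coordinates of the vectors, and over the index \<open>h\<close>. The last direction of a list is the
  first derivative to be taken, hence lists grow at their end.
\<close>

lemma shift_eq_sum_lists: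
  fixes x :: "'h \<Rightarrow> 'm::comm_monoid_add \<Rightarrow>\<^sub>0 real" and c :: "'h \<Rightarrow> real^'k::finite"
  assumes "class_C p g"
  shows "shift (\<lambda>j. \<Sum>h\<in>I. (c h $ j) *\<^sub>R x h) p (eval_at y) g =
    (\<Sum>hs | length hs = p \<and> set hs \<subseteq> I. nderiv g (map c hs) y *\<^sub>R prod_list (map x hs))"
  using assms
proof (induction p arbitrary: g)
  case 0
  have "{hs :: 'h list. length hs = 0 \<and> set hs \<subseteq> I} = {[]}" by auto
  then show ?case by (simp add: eval_at_def)
next
  case (Suc p)
  let ?L = "{hs. length hs = p \<and> set hs \<subseteq> I}"
  have C: "class_C p (partial j g)" for j
    using Suc.prems class_C_dir_deriv by blast
  have snoc: "nderiv g (map c hs @ [c h]) y = (\<Sum>j\<in>UNIV. c h $ j *\<^sub>R nderiv (partial j g) (map c hs) y)"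
    if "hs \<in> ?L" for hs h
  proof -
    have len: "length hs = p" using that by simp
    have "nderiv g (map c hs @ [c h]) y =
        nderiv (\<lambda>y. \<Sum>j\<in>UNIV. c h $ j *\<^sub>R partial j g y) (map c hs) y"
      using dir_deriv_eq_sum_partial[OF class_C_differentiable[OF Suc.prems], of "c h"]
      by (simp add: nderiv_snoc)
    also have "\<dots> = (\<Sum>j\<in>UNIV. nderiv (\<lambda>y. c h $ j *\<^sub>R partial j g y) (map c hs) y)"
      by (subst nderiv_sum)
        (auto simp: len simp del: real_scaleR_def intro!: C class_C_linear[OF bounded_linear_scaleR_right])
    also have "\<dots> = (\<Sum>j\<in>UNIV. c h $ j *\<^sub>R nderiv (partial j g) (map c hs) y)"
      by (intro sum.cong refl, subst nderiv_scaleR) (simp_all only: len length_map C)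
    finally show ?thesis .
  qed
  have "(\<Sum>hs | length hs = Suc p \<and> set hs \<subseteq> I. nderiv g (map c hs) y *\<^sub>R prod_list (map x hs)) =
      (\<Sum>hs\<in>?L. \<Sum>h\<in>I. \<Sum>j\<in>UNIV.
        ((c h $ j) *\<^sub>R x h) * (nderiv (partial j g) (map c hs) y *\<^sub>R prod_list (map x hs)))"
    unfolding sum_lists_snoc
    by (intro sum.cong refl) (simp add: snoc scaleR_sum_left mult_ac)
  also have "\<dots> = (\<Sum>j\<in>UNIV. \<Sum>hs\<in>?L. \<Sum>h\<in>I.
        ((c h $ j) *\<^sub>R x h) * (nderiv (partial j g) (map c hs) y *\<^sub>R prod_list (map x hs)))"
    by (rule trans[OF sum.cong[OF refl sum.swap] sum.swap])
  also have "\<dots> = shift (\<lambda>j. \<Sum>h\<in>I. (c h $ j) *\<^sub>R x h) (Suc p) (eval_at y) g"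
    by (simp add: Suc.IH C sum_distrib_left sum_distrib_right scaleR_sum_right)
  finally show ?case by (rule sym)
qed

lemma prod_list_basis: "prod_list (map (\<lambda>h. basis {#h#}) hs) = (basis (mset hs) :: 'd forest_alg)"
  by (induction hs) (simp_all add: mult_single)

text \<open>
  The \<open>j\<close>-th component of the algebra-valued vector \<open>\<Sum>\<^sub>h c(h) h\<close>, used as an increment.
\<close>

definition tree_sum :: "nat \<Rightarrow> ('d rtree \<Rightarrow> real^'k) \<Rightarrow> 'k \<Rightarrow> 'd forest_alg" where
  "tree_sum M c j = (\<Sum>h\<in>trees_le M. (c h $ j) *\<^sub>R basis {#h#})"

lemma ord_ge_tree_sum: "forest.ord_ge 1 (tree_sum M c j)"
proof -
  have "1 \<le> vertices h" for h :: "'a rtree" by (cases h) simp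
  then show ?thesis
    unfolding tree_sum_def
    by (intro forest.ord_ge_sum forest.ord_ge_scaleR forest.ord_ge_basis) simp
qed

lemma shift_tree_sum:
  assumes "class_C p g"
  shows "shift (tree_sum M c) p (eval_at y) g =
    (\<Sum>hs | length hs = p \<and> set hs \<subseteq> trees_le M. nderiv g (map c hs) y *\<^sub>R basis (mset hs))"
  using shift_eq_sum_lists[OF assms, of c "\<lambda>h. basis {#h#}" "trees_le M" y]
  by (simp add: tree_sum_def[abs_def] prod_list_basis)

text \<open>
  The number of lists with entries \<open>f\<close> is \<open>#f! / \<Prod>\<^sub>h f\<^sub>h!\<close>, and each of them contributes
  the same derivative, by symmetry.
\<close>

lemma lookup_taylor_tree_sum:
  fixes g :: "real^'k \<Rightarrow> real" and c :: "'d::finite rtree \<Rightarrow> real^'k"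
  assumes g: "class_C M g" and hs: "fsize (mset hs) \<le> M"
  shows "Poly_Mapping.lookup (taylor M y (tree_sum M c) g) (mset hs) =
    nderiv g (map c hs) y / (\<Prod>h\<in>set hs. fact (count (mset hs) h))"
proof -
  let ?f = "mset hs" and ?n = "length hs" and ?P = "permutations_of_multiset (mset hs)"
  have n: "?n \<le> M" using hs size_le_fsize[of ?f] by simp
  have coeff: "Poly_Mapping.lookup (shift (tree_sum M c) p (eval_at y) g) ?f =
      (if p = ?n then real (card ?P) * nderiv g (map c hs) y else 0)" if "p \<le> M" for p
  proof -
    have "{ks :: 'd rtree list. length ks = p \<and> set ks \<subseteq> trees_le M} =
        {ks. set ks \<subseteq> trees_le M \<and> length ks = p}" by auto
    then have fin: "finite {ks :: 'd rtree list. length ks = p \<and> set ks \<subseteq> trees_le M}"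
      using finite_lists_length_eq[OF finite_trees_le] by simp
    have "class_C p g" using g that class_C_mono by blast
    then have "Poly_Mapping.lookup (shift (tree_sum M c) p (eval_at y) g) ?f =
        (\<Sum>ks | length ks = p \<and> set ks \<subseteq> trees_le M. if mset ks = ?f then nderiv g (map c ks) y else 0)"
      by (simp add: shift_tree_sum lookup_sum lookup_single when_def if_distrib[of "\<lambda>x. _ * x"] cong: if_cong)
    also have "\<dots> = (\<Sum>ks | length ks = p \<and> set ks \<subseteq> trees_le M \<and> mset ks = ?f. nderiv g (map c ks) y)"
      by (rule trans[OF sum.inter_filter[OF fin, symmetric] sum.cong[OF _ refl]]) auto
    also have "\<dots> = (if p = ?n then real (card ?P) * nderiv g (map c hs) y else 0)"
    proof (cases "p = ?n")
      case True
      have "set hs \<subseteq> trees_le M"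
        using order.trans[OF vertices_le_fsize[of _ ?f] hs] by (auto simp: trees_le_def)
      moreover have "length ks = ?n" "set ks = set hs" if "mset ks = ?f" for ks
        using that mset_eq_length mset_eq_setD by blast+
      ultimately have "{ks. length ks = p \<and> set ks \<subseteq> trees_le M \<and> mset ks = ?f} = ?P"
        using True unfolding permutations_of_multiset_def by blast
      moreover have "nderiv g (map c ks) y = nderiv g (map c hs) y" if "ks \<in> ?P" for ks
      proof -
        have ks: "mset ks = ?f" using that by (rule permutations_of_multisetD)
        have "length ks = ?n" using ks mset_eq_length by blast
        then have "class_C (length (map c ks)) g" using g n class_C_mono by auto
        then have "nderiv g (map c ks) = nderiv g (map c hs)"
          by (intro nderiv_perm_real) (simp_all add: ks)
        then show ?thesis by simp
      qed
      ultimately show ?thesis using True by simp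
    next
      case False
      then have "{ks. length ks = p \<and> set ks \<subseteq> trees_le M \<and> mset ks = ?f} = {}"
        using mset_eq_length by blast
      then show ?thesis using False by (simp only: sum.empty if_False)
    qed
    finally show ?thesis .
  qed
  have "Poly_Mapping.lookup (taylor M y (tree_sum M c) g) ?f =
      (\<Sum>p\<le>M. if p = ?n then real (card ?P) * nderiv g (map c hs) y / fact ?n else 0)"
    unfolding taylor_def lookup_sum by (intro sum.cong refl) (simp add: coeff)
  also have "\<dots> = real (card ?P) * nderiv g (map c hs) y / fact ?n"
    using n by simp
  also have "\<dots> = nderiv g (map c hs) y / (\<Prod>h\<in>set hs. fact (count ?f h))"
  proof -
    have "real (card ?P) * (\<Prod>h\<in>set hs. fact (count ?f h)) = fact ?n"
      using arg_cong[OF card_permutations_of_multiset_aux[of ?f], of real] by simp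
    then show ?thesis by (simp add: field_simps flip: \<open>_ = fact ?n\<close>)
  qed
  finally show ?thesis .
qed

lemma neldiff_tree_Node: "neldiff_tree \<sigma> (Node \<mu> f) = neldiff \<sigma> \<mu> f"
  by (rule ext) (simp add: neldiff_tree_def neldiff_def sym_tree_Node eldiff_def del: sym_tree.simps eldiff_tree.simps)

text \<open>
  Since the directions are \<open>\<Upsilon>[h]/S(h)\<close>, multilinearity produces \<open>\<Prod>\<^sub>h S(h)\<close> to the power \<open>- f\<^sub>h\<close>. With the
  factor \<open>1 / \<Prod>\<^sub>h f\<^sub>h!\<close> from counting orderings, this is \<open>1 / S(f)\<close>. Only the coefficients of the
  increment at the trees of \<open>f\<close> matter, so the lemma can be used in an induction over trees.
\<close>

lemma lookup_taylor_eldiff: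
  fixes \<sigma> :: "'d::finite \<Rightarrow> real^'k \<Rightarrow> real^'k"
  assumes \<sigma>: "class_C M (\<sigma> \<mu>)" and f: "fsize f \<le> M"
    and c: "\<And>h. h \<in># f \<Longrightarrow> c h = neldiff_tree \<sigma> h y"
  shows "Poly_Mapping.lookup (taylor M y (tree_sum M c) (\<lambda>z. \<sigma> \<mu> z $ i)) f = neldiff \<sigma> \<mu> f y $ i"
proof -
  obtain hs where hs: "mset hs = f" by (metis ex_mset)
  have len: "length hs \<le> M" using f size_le_fsize[of f] hs by auto
  then have C: "class_C (length hs) (\<sigma> \<mu>)" using \<sigma> class_C_mono by blast
  let ?e = "\<lambda>h. eldiff_tree \<sigma> h y"
  have "map c hs = map (\<lambda>h. (1 / real (sym_tree h)) *\<^sub>R ?e h) hs"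
    using c hs by (auto simp: neldiff_tree_def)
  then have "nderiv (\<sigma> \<mu>) (map c hs) y =
      prod_list (map (\<lambda>h. 1 / real (sym_tree h)) hs) *\<^sub>R nderiv (\<sigma> \<mu>) (map ?e hs) y"
    by (simp only: nderiv_scale_directions[OF C])
  also have "nderiv (\<sigma> \<mu>) (map ?e hs) y = eldiff \<sigma> \<mu> f y"
    using nderiv_mset_eq[of "map ?e hs" "\<sigma> \<mu>" y] C by (simp add: eldiff_eq hs)
  also have "prod_list (map (\<lambda>h. 1 / real (sym_tree h)) hs) =
      (\<Prod>h\<in>set hs. (1 / real (sym_tree h)) ^ count f h)"
    using image_prod_mset_multiplicity[of "\<lambda>h. 1 / real (sym_tree h)" f]
    by (simp add: prod_mset_prod_list[symmetric] hs flip: hs)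
  finally have 1: "nderiv (\<sigma> \<mu>) (map c hs) y =
      (\<Prod>h\<in>set hs. (1 / real (sym_tree h)) ^ count f h) *\<^sub>R eldiff \<sigma> \<mu> f y" .
  have "Poly_Mapping.lookup (taylor M y (tree_sum M c) (\<lambda>z. \<sigma> \<mu> z $ i)) f =
      nderiv (\<lambda>z. \<sigma> \<mu> z $ i) (map c hs) y / (\<Prod>h\<in>set hs. fact (count f h))"
    using lookup_taylor_tree_sum[OF class_C_linear[OF bounded_linear_vec_nth \<sigma>], of hs y c i] f
    by (simp add: hs)
  also have "nderiv (\<lambda>z. \<sigma> \<mu> z $ i) (map c hs) y = nderiv (\<sigma> \<mu>) (map c hs) y $ i"
    using C by (intro nderiv_component) simp
  also have "\<dots> / (\<Prod>h\<in>set hs. fact (count f h)) = neldiff \<sigma> \<mu> f y $ i"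
    unfolding 1 neldiff_def sym_forest_def
    by (simp add: flip: hs) (simp add: prod.distrib prod_dividef power_divide)
  finally show ?thesis .
qed

lemma neldiff_sum_component: "neldiff_sum N \<sigma> y $ j = tree_sum (N - 1) (\<lambda>h. neldiff_tree \<sigma> h y) j"
  by (simp add: neldiff_sum_def tree_sum_def vec_scale_def sum_component)

lemma deriv_expand_component:
  fixes g :: "real^'k \<Rightarrow> real^'k" and W :: "('d::finite forest_alg)^'k"
  assumes "class_C p g"
  shows "deriv_expand N p g y W $ i =
    shift (tree_sum (N - 1) (\<lambda>h. coeff_vec {#h#} W)) p (eval_at y) (\<lambda>z. g z $ i)"
proof -
  have "class_C p (\<lambda>z. g z $ i)"
    using class_C_linear[OF bounded_linear_vec_nth assms] .
  then show ?thesis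
    using assms
    by (auto simp: deriv_expand_def vec_scale_def sum_component shift_tree_sum nderiv_component
        intro!: sum.cong)
qed


section \<open>Taylor expansion of forest-valued functions\<close>

lemma finite_forests_below: "finite {f :: 'd::finite forest. fsize f \<le> n}"
proof -
  let ?L = "{hs :: 'd rtree list. set hs \<subseteq> trees_le n \<and> length hs \<le> n}"
  have "{f :: 'd forest. fsize f \<le> n} \<subseteq> mset ` ?L"
  proof
    fix f :: "'d forest"
    assume f: "f \<in> {f. fsize f \<le> n}"
    obtain hs where hs: "mset hs = f" by (metis ex_mset)
    have "set hs \<subseteq> trees_le n"
      using f hs order.trans[OF vertices_le_fsize[of _ f]] by (auto simp: trees_le_def)
    moreover have "length hs \<le> n" using f hs size_le_fsize[of f] by auto
    ultimately show "f \<in> mset ` ?L" using hs by auto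
  qed
  moreover have "finite ?L" using finite_trees_le finite_lists_length_le by blast
  ultimately show ?thesis by (rule finite_subset[OF _ finite_imageI])
qed

lemma fsize_mono: "b \<subseteq># f \<Longrightarrow> fsize b \<le> fsize f"
  by (metis fsize_add le_add1 subset_mset.add_diff_inverse)

lemma fsize_diff: "b \<subseteq># f \<Longrightarrow> fsize (f - b) = fsize f - fsize b"
  by (metis fsize_add add_diff_cancel_left' subset_mset.add_diff_inverse)

lemma finite_subforests: "finite {b :: 'd::finite forest. b \<subseteq># f}"
  by (rule finite_subset[OF _ finite_forests_below[of "fsize f"]]) (auto intro: fsize_mono)

lemma lookup_forest_mult:
  fixes x y :: "'d::finite forest_alg"
  shows "Poly_Mapping.lookup (x * y) f =
    (\<Sum>b | b \<subseteq># f. Poly_Mapping.lookup x b * Poly_Mapping.lookup y (f - b))"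
proof (induction x rule: linear_induct)
  case (basis k)
  have "Poly_Mapping.lookup (basis k * y) f = (if k \<subseteq># f then Poly_Mapping.lookup y (f - k) else 0)"
  proof (induction y rule: linear_induct)
    case (basis l)
    show ?case
    proof (cases "k \<subseteq># f")
      case True
      then obtain m where "f = k + m" using subset_mset.add_diff_inverse by metis
      then show ?thesis by (simp add: mult_single lookup_single when_def)
    next
      case False
      then have "k + l \<noteq> f" by auto
      then show ?thesis using False by (simp add: mult_single lookup_single)
    qed
  qed (auto simp: distrib_left lookup_add)
  also have "\<dots> = (\<Sum>b | b \<subseteq># f. if b = k then Poly_Mapping.lookup y (f - k) else 0)"
    using finite_subforests by (subst sum.delta) auto
  finally show ?case
    by (simp add: lookup_single when_def) (auto intro!: sum.cong)
qed (auto simp: distrib_right lookup_add sum.distrib sum_distrib_left mult.assoc)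

text \<open>
  Elementary differentials lose one derivative per vertex, and this class keeps count. The degree
  bound \<open>L\<close> allows smoothness to be established degree by degree; the order of vanishing \<open>n\<close> pays for
  multiplication with functions that have fewer derivatives.
\<close>

definition graded_smooth :: "nat \<Rightarrow> nat \<Rightarrow> nat \<Rightarrow> (real^'k \<Rightarrow> 'd forest_alg) \<Rightarrow> bool" where
  "graded_smooth L M n G \<longleftrightarrow>
     (\<forall>b z. fsize b < n \<longrightarrow> Poly_Mapping.lookup (G z) b = 0) \<and>
     (\<forall>b. fsize b < L \<longrightarrow> class_C (M - fsize b) (\<lambda>z. Poly_Mapping.lookup (G z) b))"

lemma graded_smooth_vanish:
  "graded_smooth L M n G \<Longrightarrow> fsize b < n \<Longrightarrow> Poly_Mapping.lookup (G z) b = 0"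
  by (simp add: graded_smooth_def)

lemma graded_smooth_class_C:
  "graded_smooth L M n G \<Longrightarrow> fsize b < L \<Longrightarrow> fsize b \<le> m \<Longrightarrow>
    class_C (M - m) (\<lambda>z. Poly_Mapping.lookup (G z) b)"
  unfolding graded_smooth_def by (blast intro: class_C_mono diff_le_mono2)

lemma graded_smooth_mono: "graded_smooth L M n G \<Longrightarrow> m \<le> n \<Longrightarrow> graded_smooth L M m G"
  by (auto simp: graded_smooth_def)

lemma graded_smooth_const [simp]: "graded_smooth L M 0 (\<lambda>z. c)"
  by (auto simp: graded_smooth_def)

lemma graded_smooth_sum:
  "(\<And>i. i \<in> I \<Longrightarrow> graded_smooth L M n (G i)) \<Longrightarrow> graded_smooth L M n (\<lambda>z. \<Sum>i\<in>I. G i z)"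
  by (auto simp: graded_smooth_def lookup_sum intro!: class_C_sum)

lemma graded_smooth_mult:
  fixes G H :: "real^'k \<Rightarrow> 'd::finite forest_alg"
  assumes "graded_smooth L M m G" and "graded_smooth L M n H"
  shows "graded_smooth L M (m + n) (\<lambda>z. G z * H z)"
  unfolding graded_smooth_def lookup_forest_mult
proof (intro conjI allI impI)
  fix f :: "'d forest" and z
  assume f: "fsize f < m + n"
  have "fsize b < m \<or> fsize (f - b) < n" if "b \<subseteq># f" for b
    using f fsize_diff[OF that] fsize_mono[OF that] by linarith
  then show "(\<Sum>b | b \<subseteq># f. Poly_Mapping.lookup (G z) b * Poly_Mapping.lookup (H z) (f - b)) = 0"
    using graded_smooth_vanish[OF assms(1)] graded_smooth_vanish[OF assms(2)]
    by (intro sum.neutral ballI) (metis mem_Collect_eq mult_eq_0_iff)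
next
  fix f :: "'d forest"
  assume f: "fsize f < L"
  show "class_C (M - fsize f)
      (\<lambda>z. \<Sum>b | b \<subseteq># f. Poly_Mapping.lookup (G z) b * Poly_Mapping.lookup (H z) (f - b))"
  proof (intro class_C_sum class_C_mult)
    fix b assume "b \<in> {b. b \<subseteq># f}"
    then have b: "fsize b \<le> fsize f" "fsize (f - b) \<le> fsize f"
      using fsize_mono[of b f] fsize_diff[of b f] by auto
    show "class_C (M - fsize f) (\<lambda>z. Poly_Mapping.lookup (G z) b)"
      "class_C (M - fsize f) (\<lambda>z. Poly_Mapping.lookup (H z) (f - b))"
      using graded_smooth_class_C[OF assms(1)] graded_smooth_class_C[OF assms(2)] f b by simp_all
  qed
qed

text \<open>
  Each derivative of \<open>g\<close> comes with a factor \<open>W\<^sub>j\<close> of degree at least one, so the loss of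
  differentiability is matched by a gain in degree. The factor \<open>G\<close> accumulates these in the induction.
\<close>

lemma graded_smooth_shift:
  fixes G :: "real^'k \<Rightarrow> 'd::finite forest_alg"
  assumes "L \<le> Suc M" and W: "\<And>j. graded_smooth L M 1 (\<lambda>z. W z j)"
    and "graded_smooth L M n G" and "n < L \<Longrightarrow> class_C (M - n) g"
  shows "graded_smooth L M n (\<lambda>z. G z * shift (W z) p (eval_at z) g)"
  using assms(3,4)
proof (induction p arbitrary: n G g)
  case 0
  show ?case
    unfolding graded_smooth_def
  proof (intro conjI allI impI)
    fix b :: "'d forest" and z
    assume "fsize b < n"
    then show "Poly_Mapping.lookup (G z * shift (W z) 0 (eval_at z) g) b = 0"
      by (simp add: graded_smooth_vanish[OF 0(1)] eval_at_def)
  next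
    fix b :: "'d forest"
    assume b: "fsize b < L"
    have "class_C (M - fsize b) (\<lambda>z. g z * Poly_Mapping.lookup (G z) b)"
    proof (cases "fsize b < n")
      case True
      then show ?thesis by (simp add: graded_smooth_vanish[OF 0(1)])
    next
      case False
      then have "class_C (M - fsize b) g"
        using 0(2) b class_C_mono[of "M - n" g "M - fsize b"] by simp
      then show ?thesis
        by (rule class_C_mult) (rule graded_smooth_class_C[OF 0(1) b order.refl])
    qed
    then show "class_C (M - fsize b) (\<lambda>z. Poly_Mapping.lookup (G z * shift (W z) 0 (eval_at z) g) b)"
      by (simp add: eval_at_def)
  qed
next
  case (Suc p)
  have "graded_smooth L M (n + 1) (\<lambda>z. (G z * W z j) * shift (W z) p (eval_at z) (partial j g))" for j
  proof (rule Suc.IH)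
    show "graded_smooth L M (n + 1) (\<lambda>z. G z * W z j)"
      by (intro graded_smooth_mult Suc.prems W)
    show "class_C (M - (n + 1)) (partial j g)" if "n + 1 < L"
    proof -
      have "M - n = Suc (M - (n + 1))" using that assms(1) by simp
      then show ?thesis using Suc.prems(2) that class_C_dir_deriv by auto
    qed
  qed
  then have "graded_smooth L M (n + 1)
      (\<lambda>z. \<Sum>j\<in>UNIV. (G z * W z j) * shift (W z) p (eval_at z) (partial j g))"
    by (intro graded_smooth_sum)
  then have "graded_smooth L M n
      (\<lambda>z. \<Sum>j\<in>UNIV. (G z * W z j) * shift (W z) p (eval_at z) (partial j g))"
    by (rule graded_smooth_mono) simp
  then show ?case by (simp add: sum_distrib_left mult.assoc)
qed

lemma graded_smooth_taylor:
  fixes W :: "real^'k \<Rightarrow> 'k \<Rightarrow> 'd::finite forest_alg"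
  assumes "L \<le> Suc M" and "\<And>j. graded_smooth L M 1 (\<lambda>z. W z j)" and "class_C M g"
  shows "graded_smooth L M 0 (\<lambda>z. taylor M z (W z) g)"
proof -
  have "graded_smooth L M 0 (\<lambda>z. ((1 / fact p) *\<^sub>R 1) * shift (W z) p (eval_at z) g)" for p
    using assms by (intro graded_smooth_shift graded_smooth_const) auto
  then show ?thesis
    unfolding taylor_def by (intro graded_smooth_sum) simp
qed

text \<open>
  The operator \<open>T \<otimes> id\<close> applied to \<open>G = \<Sum>\<^sub>f G\<^sub>f f\<close>, where \<open>T\<close> expands at \<open>y\<close> with increment \<open>U\<close>: the new forests
  appear in the left tensor factor.
\<close>

definition coeff_taylor ::
    "nat \<Rightarrow> real^'k \<Rightarrow> ('k \<Rightarrow> 'd forest_tensor) \<Rightarrow> (real^'k \<Rightarrow> 'd forest_alg) \<Rightarrow> 'd forest_tensor" where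
  "coeff_taylor M y U G =
     (\<Sum>f | fsize f \<le> M. taylor M y U (\<lambda>z. Poly_Mapping.lookup (G z) f) * basis ({#}, f))"

lemma taylor_const:
  fixes U :: "'k::finite \<Rightarrow> 'm::comm_monoid_add \<Rightarrow>\<^sub>0 real"
  shows "taylor M y U (\<lambda>z. c) = c *\<^sub>R 1"
proof -
  have "taylor M y U (\<lambda>z. c) = (\<Sum>p\<le>M. if p = 0 then c *\<^sub>R 1 else 0)"
    unfolding taylor_def by (intro sum.cong refl) (simp add: jet_const)
  then show ?thesis by simp
qed

lemma ord_ge_tensor_right: "tensor.ord_ge (fsize f) (basis ({#}, f))"
  by (rule tensor.ord_ge_basis) simp

lemma ord_ge_mult_tensor_right: "n \<le> fsize f \<Longrightarrow> tensor.ord_ge n (x * basis ({#}, f))"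
  using tensor.ord_ge_mult[OF tensor.ord_ge_0(1) ord_ge_tensor_right, of f x] tensor.ord_ge_mono
  by simp

text \<open>
  The right factor \<open>f\<close> has degree \<open>|f|\<close>, so its coefficient is needed only up to degree \<open>M - |f|\<close>.
\<close>

lemma eq_below_coeff_taylorI:
  assumes "\<And>f. fsize f \<le> M \<Longrightarrow>
    tensor.eq_below (Suc (M - fsize f)) (taylor M y U (\<lambda>z. Poly_Mapping.lookup (G z) f)) (T f)"
  shows "tensor.eq_below (Suc M) (coeff_taylor M y U G) (\<Sum>f | fsize f \<le> M. T f * basis ({#}, f))"
  unfolding coeff_taylor_def
proof (rule tensor.eq_below_sum)
  fix f :: "'a forest"
  assume "f \<in> {f. fsize f \<le> M}"
  then show "tensor.eq_below (Suc M)
      (taylor M y U (\<lambda>z. Poly_Mapping.lookup (G z) f) * basis ({#}, f)) (T f * basis ({#}, f))"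
    using tensor.eq_below_mult_ord[OF assms ord_ge_tensor_right, of f f] by simp
qed

context
  fixes M :: nat and y :: "real^'k::finite" and U :: "'k \<Rightarrow> 'd::finite forest_tensor"
  assumes U: "\<And>j. tensor.ord_ge 1 (U j)"
begin

lemma coeff_taylor_const: "coeff_taylor M y U (\<lambda>z. c *\<^sub>R 1) = c *\<^sub>R 1"
proof -
  have "coeff_taylor M y U (\<lambda>z. c *\<^sub>R 1) = (\<Sum>f | fsize (f :: 'd forest) \<le> M. if f = {#} then c *\<^sub>R 1 else 0)"
    unfolding coeff_taylor_def
    by (intro sum.cong refl) (auto simp: taylor_const lookup_one when_def simp flip: zero_prod_def)
  then show ?thesis using finite_forests_below[of M, where 'd='d] by simp
qed

lemma ord_ge_coeff_taylor:
  assumes "\<And>z. Poly_Mapping.lookup (G z) {#} = 0"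
  shows "tensor.ord_ge 1 (coeff_taylor M y U G)"
  unfolding coeff_taylor_def
proof (rule tensor.ord_ge_sum)
  fix f :: "'d forest"
  show "tensor.ord_ge 1 (taylor M y U (\<lambda>z. Poly_Mapping.lookup (G z) f) * basis ({#}, f))"
  proof (cases "f = {#}")
    case True
    then show ?thesis using assms by (simp add: taylor_const)
  next
    case False
    then have "1 \<le> fsize f" using size_le_fsize[of f] by (cases f) auto
    then show ?thesis by (rule ord_ge_mult_tensor_right)
  qed
qed

lemma coeff_taylor_sum:
  assumes "\<And>i. i \<in> I \<Longrightarrow> graded_smooth (Suc M) M 0 (G i)"
  shows "tensor.eq_below (Suc M) (coeff_taylor M y U (\<lambda>z. \<Sum>i\<in>I. G i z)) (\<Sum>i\<in>I. coeff_taylor M y U (G i))"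
proof -
  have "tensor.eq_below (Suc M) (coeff_taylor M y U (\<lambda>z. \<Sum>i\<in>I. G i z))
      (\<Sum>f | fsize f \<le> M. (\<Sum>i\<in>I. taylor M y U (\<lambda>z. Poly_Mapping.lookup (G i z) f)) * basis ({#}, f))"
    by (intro eq_below_coeff_taylorI)
      (auto simp: lookup_sum intro!: tensor.taylor_sum U graded_smooth_class_C[OF assms])
  also have "(\<Sum>f | fsize f \<le> M. (\<Sum>i\<in>I. taylor M y U (\<lambda>z. Poly_Mapping.lookup (G i z) f)) * basis ({#}, f)) =
      (\<Sum>i\<in>I. coeff_taylor M y U (G i))"
    unfolding coeff_taylor_def sum_distrib_right by (rule sum.swap)
  finally show ?thesis .
qed

text \<open>
  Here \<open>g\<close> may have fewer derivatives than a degree zero coefficient of a \<open>graded_smooth\<close> function. This is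
  compensated by \<open>G\<close>, all of whose terms have degree at least \<open>n\<close>.
\<close>

lemma coeff_taylor_scalar:
  assumes G: "graded_smooth (Suc M) M n G" and g: "n \<le> M \<Longrightarrow> class_C (M - n) g"
  shows "tensor.eq_below (Suc M) (coeff_taylor M y U (\<lambda>z. G z * (g z *\<^sub>R 1)))
    (coeff_taylor M y U G * taylor M y U g)"
proof -
  have "tensor.eq_below (Suc M) (coeff_taylor M y U (\<lambda>z. G z * (g z *\<^sub>R 1)))
      (\<Sum>f | fsize f \<le> M. (taylor M y U (\<lambda>z. Poly_Mapping.lookup (G z) f) * taylor M y U g) * basis ({#}, f))"
  proof (rule eq_below_coeff_taylorI)
    fix f :: "'d forest"
    assume f: "fsize f \<le> M"
    show "tensor.eq_below (Suc (M - fsize f))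
        (taylor M y U (\<lambda>z. Poly_Mapping.lookup (G z * (g z *\<^sub>R 1)) f))
        (taylor M y U (\<lambda>z. Poly_Mapping.lookup (G z) f) * taylor M y U g)"
    proof (cases "fsize f < n")
      case True
      then have "Poly_Mapping.lookup (G z) f = 0" for z by (rule graded_smooth_vanish[OF G])
      then show ?thesis by (simp add: taylor_const)
    next
      case False
      have "class_C (M - fsize f) g"
        using g f False class_C_mono[of "M - n" g "M - fsize f"] by simp
      then have "tensor.eq_below (Suc (M - fsize f))
          (taylor M y U (\<lambda>z. Poly_Mapping.lookup (G z) f * g z))
          (taylor M y U (\<lambda>z. Poly_Mapping.lookup (G z) f) * taylor M y U g)"
        using graded_smooth_class_C[OF G, of f] f by (intro tensor.taylor_mult U) auto
      then show ?thesis by (simp add: mult.commute)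
    qed
  qed
  then show ?thesis
    by (simp add: coeff_taylor_def sum_distrib_left sum_distrib_right mult_ac)
qed

lemma coeff_taylor_mult:
  assumes G: "graded_smooth (Suc M) M 0 G" and H: "graded_smooth (Suc M) M 0 H"
  shows "tensor.eq_below (Suc M) (coeff_taylor M y U (\<lambda>z. G z * H z))
    (coeff_taylor M y U G * coeff_taylor M y U H)"
proof -
  let ?TG = "\<lambda>f. taylor M y U (\<lambda>z. Poly_Mapping.lookup (G z) f)"
  let ?TH = "\<lambda>f. taylor M y U (\<lambda>z. Poly_Mapping.lookup (H z) f)"
  let ?F = "{f :: 'd forest. fsize f \<le> M}"
  let ?e = "\<lambda>b c. (?TG b * ?TH c) * basis ({#}, b + c)"
  have "tensor.eq_below (Suc M) (coeff_taylor M y U (\<lambda>z. G z * H z))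
      (\<Sum>f\<in>?F. (\<Sum>b | b \<subseteq># f. ?TG b * ?TH (f - b)) * basis ({#}, f))"
  proof (rule eq_below_coeff_taylorI)
    fix f :: "'d forest"
    assume f: "fsize f \<le> M"
    have C: "class_C (M - fsize f) (\<lambda>z. Poly_Mapping.lookup (G z) b)"
      "class_C (M - fsize f) (\<lambda>z. Poly_Mapping.lookup (H z) (f - b))" if "b \<subseteq># f" for b
    proof -
      have "fsize b \<le> fsize f" "fsize (f - b) \<le> fsize f"
        using fsize_mono[OF that] fsize_diff[OF that] by auto
      then show "class_C (M - fsize f) (\<lambda>z. Poly_Mapping.lookup (G z) b)"
        "class_C (M - fsize f) (\<lambda>z. Poly_Mapping.lookup (H z) (f - b))"
        using graded_smooth_class_C[OF G] graded_smooth_class_C[OF H] f by simp_all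
    qed
    have "tensor.eq_below (Suc (M - fsize f)) (taylor M y U (\<lambda>z. Poly_Mapping.lookup (G z * H z) f))
        (\<Sum>b | b \<subseteq># f. taylor M y U (\<lambda>z. Poly_Mapping.lookup (G z) b * Poly_Mapping.lookup (H z) (f - b)))"
      unfolding lookup_forest_mult by (intro tensor.taylor_sum U class_C_mult C) auto
    also have "tensor.eq_below (Suc (M - fsize f)) \<dots> (\<Sum>b | b \<subseteq># f. ?TG b * ?TH (f - b))"
      by (intro tensor.eq_below_sum tensor.taylor_mult U C) auto
    finally show "tensor.eq_below (Suc (M - fsize f))
        (taylor M y U (\<lambda>z. Poly_Mapping.lookup (G z * H z) f)) (\<Sum>b | b \<subseteq># f. ?TG b * ?TH (f - b))" .
  qed
  also have "(\<Sum>f\<in>?F. (\<Sum>b | b \<subseteq># f. ?TG b * ?TH (f - b)) * basis ({#}, f)) =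
      (\<Sum>(f, b)\<in>Sigma ?F (\<lambda>f. {b. b \<subseteq># f}). ?e b (f - b))"
    using finite_forests_below finite_subforests
    by (subst sum.Sigma[symmetric]) (auto simp: sum_distrib_right intro!: sum.cong)
  \<comment> \<open>A forest with a marked part \<open>b\<close> is a pair of forests, \<open>b\<close> and the rest.\<close>
  also have "\<dots> = (\<Sum>(b, c)\<in>{(b, c). fsize b + fsize c \<le> M}. ?e b c)"
    by (rule sum.reindex_bij_witness[where i = "\<lambda>(b, c). (b + c, b)" and j = "\<lambda>(f, b). (b, f - b)"])
      (auto simp: fsize_add[symmetric])
  also have "tensor.eq_below (Suc M) \<dots>
      ((\<Sum>(b, c)\<in>{(b, c). fsize b + fsize c \<le> M}. ?e b c) +
        (\<Sum>(b, c)\<in>?F \<times> ?F - {(b, c). fsize b + fsize c \<le> M}. ?e b c))" (is "tensor.eq_below _ ?S (?S + ?R)")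
  proof -
    have "tensor.ord_ge (Suc M) (?e b c)" if "\<not> fsize b + fsize c \<le> M" for b c
      using that by (intro ord_ge_mult_tensor_right) (simp add: fsize_add)
    then have "tensor.eq_below (Suc M) ?R 0"
      unfolding tensor.ord_ge_iff[symmetric] by (intro tensor.ord_ge_sum) auto
    from tensor.eq_below_add[OF tensor.eq_below_refl[of _ ?S] this] show ?thesis
      using tensor.eq_below_sym by simp
  qed
  also have "?S + ?R = (\<Sum>(b, c)\<in>?F \<times> ?F. ?e b c)"
    using finite_forests_below by (subst add.commute, intro sum.subset_diff[symmetric]) auto
  also have "\<dots> = coeff_taylor M y U G * coeff_taylor M y U H"
  proof -
    have e: "basis ({#}, b + c) = basis ({#}, b) * (basis ({#}, c) :: 'd forest_tensor)" for b c :: "'d forest"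
      by (simp add: mult_single)
    show ?thesis
      unfolding coeff_taylor_def sum_product sum.cartesian_product
      by (intro sum.cong refl) (auto simp: e mult_ac)
  qed
  finally show ?thesis .
qed

text \<open>
  By multiplicativity, \<open>T \<otimes> id\<close> passes through each factor \<open>W\<^sub>j\<close> of
  \<open>G \<cdot> (\<Sum>\<^sub>j W\<^sub>j \<partial>\<^sub>j)\<^sup>p g\<close>, and ends up as \<open>T\<close> on the derivatives of \<open>g\<close>. The factor \<open>G\<close> makes
  the induction possible: it absorbs one \<open>W\<^sub>j\<close> at a time.
\<close>

lemma coeff_taylor_shift:
  assumes W: "\<And>j. graded_smooth (Suc M) M 1 (\<lambda>z. W z j)"
    and "graded_smooth (Suc M) M n G" and "n \<le> M \<Longrightarrow> class_C (M - n) g"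
  shows "tensor.eq_below (Suc M) (coeff_taylor M y U (\<lambda>z. G z * shift (W z) p (eval_at z) g))
    (coeff_taylor M y U G * shift (\<lambda>j. coeff_taylor M y U (\<lambda>z. W z j)) p (taylor M y U) g)"
  using assms(2,3)
proof (induction p arbitrary: n G g)
  case 0
  then show ?case
    using coeff_taylor_scalar[OF 0(1), of g] by (simp add: eval_at_def)
next
  case (Suc p)
  let ?CT = "coeff_taylor M y U"
  let ?V = "\<lambda>j. ?CT (\<lambda>z. W z j)"
  have C: "class_C (M - (n + 1)) (partial j g)" if "n + 1 \<le> M" for j
  proof -
    have "M - n = Suc (M - (n + 1))" using that by simp
    then show ?thesis using Suc.prems(2) that class_C_dir_deriv by auto
  qed
  have GW: "graded_smooth (Suc M) M (n + 1) (\<lambda>z. G z * W z j)" for j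
    by (intro graded_smooth_mult Suc.prems W)
  have "graded_smooth (Suc M) M (n + 1) (\<lambda>z. (G z * W z j) * shift (W z) p (eval_at z) (partial j g))" for j
    using C by (intro graded_smooth_shift W GW) auto
  then have sm: "graded_smooth (Suc M) M 0 (\<lambda>z. (G z * W z j) * shift (W z) p (eval_at z) (partial j g))" for j
    by (rule graded_smooth_mono) simp
  have "(\<lambda>z. G z * shift (W z) (Suc p) (eval_at z) g) =
      (\<lambda>z. \<Sum>j\<in>UNIV. (G z * W z j) * shift (W z) p (eval_at z) (partial j g))"
    by (simp add: sum_distrib_left mult.assoc)
  moreover have "tensor.eq_below (Suc M) (?CT (\<lambda>z. \<Sum>j\<in>UNIV. (G z * W z j) * shift (W z) p (eval_at z) (partial j g)))
      (\<Sum>j\<in>UNIV. ?CT (\<lambda>z. (G z * W z j) * shift (W z) p (eval_at z) (partial j g)))"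
    by (rule coeff_taylor_sum) (rule sm)
  moreover have "tensor.eq_below (Suc M)
      (\<Sum>j\<in>UNIV. ?CT (\<lambda>z. (G z * W z j) * shift (W z) p (eval_at z) (partial j g)))
      (\<Sum>j\<in>UNIV. (?CT G * ?V j) * shift ?V p (taylor M y U) (partial j g))"
  proof (rule tensor.eq_below_sum)
    fix j :: 'k
    have "tensor.eq_below (Suc M) (?CT (\<lambda>z. (G z * W z j) * shift (W z) p (eval_at z) (partial j g)))
        (?CT (\<lambda>z. G z * W z j) * shift ?V p (taylor M y U) (partial j g))"
      using Suc.IH[OF GW C] .
    also have "tensor.eq_below (Suc M) \<dots> ((?CT G * ?V j) * shift ?V p (taylor M y U) (partial j g))"
      using Suc.prems(1) W graded_smooth_mono
      by (intro tensor.eq_below_mult tensor.eq_below_refl coeff_taylor_mult) blast+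
    finally show "tensor.eq_below (Suc M) (?CT (\<lambda>z. (G z * W z j) * shift (W z) p (eval_at z) (partial j g)))
        ((?CT G * ?V j) * shift ?V p (taylor M y U) (partial j g))" .
  qed
  moreover have "(\<Sum>j\<in>UNIV. (?CT G * ?V j) * shift ?V p (taylor M y U) (partial j g)) =
      ?CT G * shift ?V (Suc p) (taylor M y U) g"
    by (simp add: sum_distrib_left mult.assoc)
  ultimately show ?case
    by (metis (no_types, lifting) tensor.eq_below_trans)
qed

text \<open>
  Expanding the function \<open>z \<mapsto> g(z + W(z))\<close> at \<open>y\<close> with increment \<open>U\<close> replaces \<open>z\<close> by \<open>y + U\<close> and
  \<open>W(z)\<close> by its own expansion.
\<close>

lemma coeff_taylor_taylor:
  assumes W: "\<And>j. graded_smooth (Suc M) M 1 (\<lambda>z. W z j)" and g: "class_C M g"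
  shows "tensor.eq_below (Suc M) (coeff_taylor M y U (\<lambda>z. taylor M z (W z) g))
    (taylor M y (\<lambda>j. U j + coeff_taylor M y U (\<lambda>z. W z j)) g)"
proof -
  let ?CT = "coeff_taylor M y U"
  let ?V = "\<lambda>j. ?CT (\<lambda>z. W z j)"
  let ?G = "\<lambda>p z. ((1 / fact p) *\<^sub>R 1) * shift (W z) p (eval_at z) g"
  have V: "tensor.ord_ge 1 (?V j)" for j
    by (intro ord_ge_coeff_taylor graded_smooth_vanish[OF W]) simp
  have "(\<lambda>z. taylor M z (W z) g) = (\<lambda>z. \<Sum>p\<le>M. ?G p z)"
    by (simp add: taylor_def)
  moreover have "graded_smooth (Suc M) M 0 (?G p)" for p
    using g by (intro graded_smooth_shift W graded_smooth_const) auto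
  ultimately have "tensor.eq_below (Suc M) (?CT (\<lambda>z. taylor M z (W z) g)) (\<Sum>p\<le>M. ?CT (?G p))"
    by (simp only: coeff_taylor_sum)
  also have "tensor.eq_below (Suc M) \<dots>
      (\<Sum>p\<le>M. ((1 / fact p) *\<^sub>R 1) * shift ?V p (taylor M y U) g)"
  proof (rule tensor.eq_below_sum)
    fix p
    show "tensor.eq_below (Suc M) (?CT (?G p)) (((1 / fact p) *\<^sub>R 1) * shift ?V p (taylor M y U) g)"
      unfolding coeff_taylor_const[symmetric] using g
      by (intro coeff_taylor_shift[where n = 0] W graded_smooth_const) auto
  qed
  also have "\<dots> = (\<Sum>p\<le>M. (1 / fact p) *\<^sub>R shift ?V p (taylor M y U) g)"
    by simp
  also have "tensor.eq_below (Suc M) \<dots> (taylor M y (\<lambda>j. U j + ?V j) g)"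
    by (intro tensor.eq_below_sym[OF tensor.taylor_add_directions] U V g)
  finally show ?thesis .
qed

end


section \<open>Elementary differentials and the coproduct\<close>

text \<open>
  The generating series of the normalised elementary differentials over trees.
\<close>

abbreviation eldiff_gen ::
    "nat \<Rightarrow> ('d \<Rightarrow> real^'k \<Rightarrow> real^'k) \<Rightarrow> real^'k \<Rightarrow> 'k \<Rightarrow> 'd forest_alg" where
  "eldiff_gen M \<sigma> z \<equiv> tree_sum M (\<lambda>h. neldiff_tree \<sigma> h z)"

lemma lookup_tree_sum_single:
  "h \<in> trees_le M \<Longrightarrow> Poly_Mapping.lookup (tree_sum M c j) {#h#} = c (h :: 'd::finite rtree) $ j"
proof -
  assume h: "h \<in> trees_le M"
  have "Poly_Mapping.lookup (tree_sum M c j) {#h#} = (\<Sum>k\<in>trees_le M. if k = h then c h $ j else 0)"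
    unfolding tree_sum_def lookup_sum by (intro sum.cong refl) (auto simp: lookup_single when_def)
  then show ?thesis using h by (simp add: finite_trees_le)
qed

lemma lookup_tree_sum_eq_0:
  "b \<notin> (\<lambda>h. {#h#}) ` trees_le M \<Longrightarrow> Poly_Mapping.lookup (tree_sum M c j) b = 0"
  unfolding tree_sum_def lookup_sum by (intro sum.neutral) (auto simp: lookup_single when_def)

lemma sum_trees_le:
  fixes F :: "'d::finite rtree \<Rightarrow> 'b::comm_monoid_add"
  shows "(\<Sum>h\<in>trees_le M. F h) = (\<Sum>\<nu>\<in>UNIV. \<Sum>f | fsize f < M. F (Node \<nu> f))"
proof -
  have "trees_le M = (\<lambda>(\<nu>, f). Node \<nu> f) ` (UNIV \<times> {f :: 'd forest. fsize f < M})"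
  proof (intro equalityI subsetI)
    fix h :: "'d rtree" assume "h \<in> trees_le M"
    then show "h \<in> (\<lambda>(\<nu>, f). Node \<nu> f) ` (UNIV \<times> {f. fsize f < M})"
      by (cases h) (force simp: trees_le_def vertices_Node simp del: vertices.simps)
  qed (auto simp: trees_le_def vertices_Node simp del: vertices.simps)
  moreover have "inj_on (\<lambda>(\<nu>, f). Node \<nu> f) X" for X :: "('d \<times> 'd forest) set"
    by (auto intro: inj_onI)
  ultimately show ?thesis
    by (simp add: sum.reindex sum.cartesian_product case_prod_unfold)
qed

lemma eq_below_sum_lookup:
  fixes x :: "'d::finite forest_alg"
  shows "forest.eq_below M x (\<Sum>f | fsize f < M. Poly_Mapping.lookup x f *\<^sub>R basis f)"
  unfolding forest.eq_below_def
proof (intro allI impI)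
  fix k :: "'d forest"
  assume k: "fsize k < M"
  have fin: "finite {f :: 'd forest. fsize f < M}"
    by (rule finite_subset[OF _ finite_forests_below[of M]]) auto
  have "Poly_Mapping.lookup (\<Sum>f | fsize f < M. Poly_Mapping.lookup x f *\<^sub>R basis f) k =
      (\<Sum>f | fsize f < M. if f = k then Poly_Mapping.lookup x k else 0)"
    unfolding lookup_sum by (intro sum.cong refl) (auto simp: lookup_single when_def)
  then show "Poly_Mapping.lookup x k =
      Poly_Mapping.lookup (\<Sum>f | fsize f < M. Poly_Mapping.lookup x f *\<^sub>R basis f) k"
    using k fin by simp
qed

lemma class_C_vec:
  fixes g :: "'a::euclidean_space \<Rightarrow> real^'k"
  assumes "\<And>i. class_C n (\<lambda>z. g z $ i)"
  shows "class_C n g"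
proof -
  have "class_C n (\<lambda>z. \<Sum>i\<in>UNIV. g z $ i *\<^sub>R axis i (1 :: real))"
    by (intro class_C_sum class_C_linear[OF bounded_linear_scaleR_left] assms)
  then show ?thesis by (simp flip: vec_eq_sum_axis)
qed

context
  fixes M :: nat and \<sigma> :: "'d::finite \<Rightarrow> real^'k \<Rightarrow> real^'k"
  assumes \<sigma>: "\<And>\<nu>. class_C M (\<sigma> \<nu>)"
begin

lemma class_C_component: "class_C M (\<lambda>z. \<sigma> \<nu> z $ i)"
  using class_C_linear[OF bounded_linear_vec_nth \<sigma>] .

lemma lookup_taylor_eldiff_gen:
  "fsize f \<le> M \<Longrightarrow>
    Poly_Mapping.lookup (taylor M z (eldiff_gen M \<sigma> z) (\<lambda>x. \<sigma> \<nu> x $ i)) f = neldiff \<sigma> \<nu> f z $ i"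
  using lookup_taylor_eldiff[of M \<sigma> \<nu> f "\<lambda>h. neldiff_tree \<sigma> h z" z i] \<sigma> by simp

text \<open>
  The coefficient at \<open>[f]\<^sub>\<nu>\<close> is a coefficient of the Taylor expansion of \<open>\<sigma>\<^sub>\<nu>\<close> whose increment is the
  series itself, and involves only smaller trees. The induction therefore runs over the bound \<open>m\<close> on the degree.
\<close>

lemma graded_smooth_eldiff_gen:
  "m \<le> Suc M \<Longrightarrow> graded_smooth m M 1 (\<lambda>z. eldiff_gen M \<sigma> z j)"
proof (induction m arbitrary: j)
  case 0
  show ?case
    using ord_ge_tree_sum[of M _ j] by (auto simp: graded_smooth_def forest.ord_ge_def)
next
  case (Suc m)
  have IH: "graded_smooth m M 1 (\<lambda>z. eldiff_gen M \<sigma> z j)" for j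
    using Suc by simp
  have "class_C (M - fsize b) (\<lambda>z. Poly_Mapping.lookup (eldiff_gen M \<sigma> z j) b)"
    if b: "fsize b < Suc m" for b
  proof (cases "b \<in> (\<lambda>h. {#h#}) ` trees_le M")
    case True
    then obtain \<nu> f where h: "b = {#Node \<nu> f#}" "Node \<nu> f \<in> trees_le M"
      by (metis imageE rtree.exhaust)
    then have f: "fsize f < m" "fsize f \<le> M" "fsize f \<le> fsize b"
      using b Suc.prems by (auto simp: vertices_Node simp del: vertices.simps)
    have "graded_smooth m M 0 (\<lambda>z. taylor M z (eldiff_gen M \<sigma> z) (\<lambda>x. \<sigma> \<nu> x $ j))"
      using Suc.prems by (intro graded_smooth_taylor IH class_C_component) auto
    then have "class_C (M - fsize b) (\<lambda>z. Poly_Mapping.lookup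
        (taylor M z (eldiff_gen M \<sigma> z) (\<lambda>x. \<sigma> \<nu> x $ j)) f)"
      by (rule graded_smooth_class_C) (use f in auto)
    then show ?thesis
      by (simp add: h lookup_tree_sum_single neldiff_tree_Node lookup_taylor_eldiff_gen[OF f(2)])
  next
    case False
    then show ?thesis by (simp add: lookup_tree_sum_eq_0)
  qed
  then show ?case
    using graded_smooth_vanish[OF IH] by (simp add: graded_smooth_def)
qed

lemma class_C_neldiff:
  assumes "fsize f \<le> M"
  shows "class_C (M - fsize f) (neldiff \<sigma> \<nu> f)"
proof (rule class_C_vec)
  fix i
  have "graded_smooth (Suc M) M 0 (\<lambda>z. taylor M z (eldiff_gen M \<sigma> z) (\<lambda>x. \<sigma> \<nu> x $ i))"
    by (intro graded_smooth_taylor graded_smooth_eldiff_gen class_C_component) auto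
  from graded_smooth_class_C[OF this, of f "fsize f"] assms
  show "class_C (M - fsize f) (\<lambda>z. neldiff \<sigma> \<nu> f z $ i)"
    by (simp add: lookup_taylor_eldiff_gen)
qed

lemma ord_ge_tensor_left_tree_sum: "tensor.ord_ge 1 (tensor_left (tree_sum M c j))"
  using eq_below_tensor_left[of 1 "tree_sum M c j" 0] ord_ge_tree_sum[of M c j]
  by (simp add: forest.ord_ge_iff tensor.ord_ge_iff linear_0[OF linear_tensor_left])

lemma taylor_tensor_left:
  "taylor M y (\<lambda>j. tensor_left (W j)) g = tensor_left (taylor M y W g)"
  by (simp add: taylor_hom[OF linear_tensor_left tensor_left_mult tensor_left_one])

text \<open>
  The recursion \<open>\<Delta>[f]\<^sub>\<nu> = [f]\<^sub>\<nu> \<otimes> 1 + (id \<otimes> [.]\<^sub>\<nu>) \<Delta>f\<close>, summed over all trees.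
\<close>

lemma coprod_eldiff_gen:
  "tensor.eq_below (Suc M) (coprod (eldiff_gen M \<sigma> y j))
    (tensor_left (eldiff_gen M \<sigma> y j) +
      (\<Sum>\<nu>\<in>UNIV. id_tensor_graft \<nu> (coprod (taylor M y (eldiff_gen M \<sigma> y) (\<lambda>x. \<sigma> \<nu> x $ j)))))"
proof -
  let ?P = "\<lambda>\<nu>. taylor M y (eldiff_gen M \<sigma> y) (\<lambda>x. \<sigma> \<nu> x $ j)"
  let ?Q = "\<lambda>\<nu>. (\<Sum>f | fsize f < M. Poly_Mapping.lookup (?P \<nu>) f *\<^sub>R basis f)"
  have graft: "id_tensor_graft \<nu> (coprod (?Q \<nu>)) =
      (\<Sum>f | fsize f < M. (neldiff_tree \<sigma> (Node \<nu> f) y $ j) *\<^sub>R id_tensor_graft \<nu> (coprod_forest f))" for \<nu>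
    by (simp add: linear_sum[OF linear_coprod] linear_scale[OF linear_coprod]
        linear_sum[OF linear_graft] linear_scale[OF linear_graft] lookup_taylor_eldiff_gen neldiff_tree_Node)
  have "coprod (eldiff_gen M \<sigma> y j) = (\<Sum>\<nu>\<in>UNIV. \<Sum>f | fsize f < M.
      (neldiff_tree \<sigma> (Node \<nu> f) y $ j) *\<^sub>R coprod_tree (Node \<nu> f))"
    by (simp add: tree_sum_def linear_sum[OF linear_coprod] linear_scale[OF linear_coprod]
        coprod_forest_single sum_trees_le del: coprod_tree.simps)
  also have "\<dots> = tensor_left (eldiff_gen M \<sigma> y j) + (\<Sum>\<nu>\<in>UNIV. id_tensor_graft \<nu> (coprod (?Q \<nu>)))"
    unfolding graft
    by (simp add: tree_sum_def linear_sum[OF linear_tensor_left] linear_scale[OF linear_tensor_left]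
        sum_trees_le coprod_tree_Node scaleR_right_distrib sum.distrib del: coprod_tree.simps)
  also have "tensor.eq_below (Suc M) \<dots> (tensor_left (eldiff_gen M \<sigma> y j) +
      (\<Sum>\<nu>\<in>UNIV. id_tensor_graft \<nu> (coprod (?P \<nu>))))"
    by (intro tensor.eq_below_add tensor.eq_below_refl tensor.eq_below_sum eq_below_graft
        eq_below_coprod forest.eq_below_sym[OF eq_below_sum_lookup])
  finally show ?thesis .
qed

text \<open>
  Every tree is \<open>[f]\<^sub>\<nu>\<close> for a unique \<open>f\<close>, and \<open>\<Upsilon>[[f]\<^sub>\<nu>] = \<Upsilon>\<^sub>\<nu>[f]\<close>, so the increment arising in
  \<open>coeff_taylor_taylor\<close> is obtained by grafting.
\<close>

lemma coeff_taylor_eldiff_gen: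
  fixes y :: "real^'k"
  defines "U \<equiv> \<lambda>j. tensor_left (eldiff_gen M \<sigma> y j)"
  shows "tensor.eq_below (Suc M) (coeff_taylor M y U (\<lambda>z. eldiff_gen M \<sigma> z j))
    (\<Sum>\<nu>\<in>UNIV. id_tensor_graft \<nu>
      (coeff_taylor M y U (\<lambda>z. taylor M z (eldiff_gen M \<sigma> z) (\<lambda>x. \<sigma> \<nu> x $ j))))"
proof -
  let ?T = "taylor M y U"
  let ?R = "\<lambda>\<nu>. coeff_taylor M y U (\<lambda>z. taylor M z (eldiff_gen M \<sigma> z) (\<lambda>x. \<sigma> \<nu> x $ j))"
  let ?Q = "\<lambda>\<nu>. \<Sum>f | fsize f < M. ?T (\<lambda>z. neldiff \<sigma> \<nu> f z $ j) * basis ({#}, f)"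
  have fin: "finite {f :: 'd forest. fsize f \<le> M}" by (rule finite_forests_below)
  have "coeff_taylor M y U (\<lambda>z. eldiff_gen M \<sigma> z j) =
      (\<Sum>f\<in>(\<lambda>h. {#h#}) ` trees_le M. ?T (\<lambda>z. Poly_Mapping.lookup (eldiff_gen M \<sigma> z j) f) * basis ({#}, f))"
    unfolding coeff_taylor_def
    by (rule sum.mono_neutral_right[OF fin])
      (auto simp: trees_le_def lookup_tree_sum_eq_0 taylor_const)
  also have "\<dots> = (\<Sum>h\<in>trees_le M. ?T (\<lambda>z. neldiff_tree \<sigma> h z $ j) * basis ({#}, {#h#}))"
    by (subst sum.reindex) (auto simp: inj_on_def lookup_tree_sum_single intro!: sum.cong)
  also have "\<dots> = (\<Sum>\<nu>\<in>UNIV. id_tensor_graft \<nu> (?Q \<nu>))"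
    by (simp add: sum_trees_le linear_sum[OF linear_graft] neldiff_tree_Node U_def
        taylor_tensor_left graft_tensor_left)
  also have "tensor.eq_below (Suc M) \<dots> (\<Sum>\<nu>\<in>UNIV. id_tensor_graft \<nu> (?R \<nu>))"
  proof (intro tensor.eq_below_sum eq_below_graft)
    fix \<nu>
    have R: "?R \<nu> = (\<Sum>f | fsize f \<le> M. ?T (\<lambda>z. neldiff \<sigma> \<nu> f z $ j) * basis ({#}, f))"
      unfolding coeff_taylor_def by (intro sum.cong refl) (simp add: lookup_taylor_eldiff_gen)
    \<comment> \<open>Forests with \<open>M\<close> vertices are left over: they are grafted to trees with \<open>M + 1\<close> vertices.\<close>
    have "?R \<nu> - ?Q \<nu> = (\<Sum>f\<in>{f. fsize f \<le> M} - {f. fsize f < M}.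
        ?T (\<lambda>z. neldiff \<sigma> \<nu> f z $ j) * basis ({#}, f))"
      unfolding R using fin by (subst sum_diff) auto
    then have "tensor.ord_ge M (?R \<nu> - ?Q \<nu>)"
      by (auto intro!: tensor.ord_ge_sum ord_ge_mult_tensor_right)
    then show "tensor.eq_below M (?Q \<nu>) (?R \<nu>)"
      unfolding tensor.eq_below_iff[symmetric] by (rule tensor.eq_below_sym)
  qed
  finally show ?thesis .
qed

text \<open>
  Both sides are Taylor expansions of \<open>\<sigma>\<^sub>\<mu>\<close> at \<open>y\<close>, with increments built by grafting from the two
  sides themselves. Agreement thus propagates from each degree to the next.
\<close>

theorem coprod_taylor_eldiff_gen:
  fixes y :: "real^'k"
  defines "U \<equiv> \<lambda>j. tensor_left (eldiff_gen M \<sigma> y j)"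
  shows "tensor.eq_below (Suc M)
    (coprod (taylor M y (eldiff_gen M \<sigma> y) (\<lambda>x. \<sigma> \<mu> x $ i)))
    (coeff_taylor M y U (\<lambda>z. taylor M z (eldiff_gen M \<sigma> z) (\<lambda>x. \<sigma> \<mu> x $ i)))"
proof -
  let ?L = "\<lambda>\<nu> i. coprod (taylor M y (eldiff_gen M \<sigma> y) (\<lambda>x. \<sigma> \<nu> x $ i))"
  let ?R = "\<lambda>\<nu> i. coeff_taylor M y U (\<lambda>z. taylor M z (eldiff_gen M \<sigma> z) (\<lambda>x. \<sigma> \<nu> x $ i))"
  have "n \<le> Suc M \<Longrightarrow> tensor.eq_below n (?L \<nu> i) (?R \<nu> i)" for n \<nu> i
  proof (induction n arbitrary: \<nu> i)
    case 0
    show ?case by (simp add: tensor.eq_below_def)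
  next
    case (Suc n)
    have IH: "tensor.eq_below n (?L \<nu> i) (?R \<nu> i)" for \<nu> i
      using Suc by simp
    let ?V = "\<lambda>j. coeff_taylor M y U (\<lambda>z. eldiff_gen M \<sigma> z j)"
    have UV: "tensor.eq_below (Suc n) (coprod (eldiff_gen M \<sigma> y j)) (U j + ?V j)" for j
    proof -
      have "tensor.eq_below (Suc n) (coprod (eldiff_gen M \<sigma> y j))
          (U j + (\<Sum>\<nu>\<in>UNIV. id_tensor_graft \<nu> (?L \<nu> j)))"
        unfolding U_def by (rule tensor.eq_below_mono[OF coprod_eldiff_gen Suc.prems])
      also have "tensor.eq_below (Suc n) \<dots> (U j + (\<Sum>\<nu>\<in>UNIV. id_tensor_graft \<nu> (?R \<nu> j)))"
        by (intro tensor.eq_below_add tensor.eq_below_sum tensor.eq_below_refl eq_below_graft IH)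
      also have "tensor.eq_below (Suc n) \<dots> (U j + ?V j)"
        unfolding U_def
        by (intro tensor.eq_below_add tensor.eq_below_refl
            tensor.eq_below_sym[OF tensor.eq_below_mono[OF coeff_taylor_eldiff_gen Suc.prems]])
      finally show ?thesis .
    qed
    have "?L \<nu> i = taylor M y (\<lambda>j. coprod (eldiff_gen M \<sigma> y j)) (\<lambda>x. \<sigma> \<nu> x $ i)"
      by (rule taylor_hom[OF linear_coprod coprod_mult coprod_one])
    also have "tensor.eq_below (Suc n) \<dots> (taylor M y (\<lambda>j. U j + ?V j) (\<lambda>x. \<sigma> \<nu> x $ i))"
      by (rule tensor.eq_below_taylor[OF UV])
    also have "tensor.eq_below (Suc n) \<dots> (?R \<nu> i)"
    proof (rule tensor.eq_below_mono[OF tensor.eq_below_sym Suc.prems])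
      show "tensor.eq_below (Suc M) (?R \<nu> i) (taylor M y (\<lambda>j. U j + ?V j) (\<lambda>x. \<sigma> \<nu> x $ i))"
        unfolding U_def
        by (intro coeff_taylor_taylor ord_ge_tensor_left_tree_sum graded_smooth_eldiff_gen
            class_C_component) auto
    qed
    finally show ?case .
  qed
  then show ?thesis by blast
qed

lemma lookup_coprod_taylor:
  assumes "fsize a + fsize f \<le> M"
  shows "Poly_Mapping.lookup (coprod (taylor M y (eldiff_gen M \<sigma> y) (\<lambda>x. \<sigma> \<mu> x $ i))) (a, f) =
    Poly_Mapping.lookup (taylor M y (eldiff_gen M \<sigma> y) (\<lambda>z. neldiff \<sigma> \<mu> f z $ i)) a"
proof -
  have "Poly_Mapping.lookup (coprod (taylor M y (eldiff_gen M \<sigma> y) (\<lambda>x. \<sigma> \<mu> x $ i))) (a, f) =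
      (\<Sum>g | fsize g \<le> M. Poly_Mapping.lookup
        (tensor_left (taylor M y (eldiff_gen M \<sigma> y) (\<lambda>z. neldiff \<sigma> \<mu> g z $ i)) * basis ({#}, g)) (a, f))"
    using coprod_taylor_eldiff_gen[of y \<mu> i] assms
    by (simp add: tensor.eq_below_def coeff_taylor_def lookup_sum taylor_tensor_left
        lookup_taylor_eldiff_gen)
  also have "\<dots> = (\<Sum>g | fsize g \<le> M. if g = f then
      Poly_Mapping.lookup (taylor M y (eldiff_gen M \<sigma> y) (\<lambda>z. neldiff \<sigma> \<mu> f z $ i)) a else 0)"
    by (intro sum.cong refl) (auto simp: lookup_tensor_left_mult)
  finally show ?thesis using assms finite_forests_below[of M, where 'd='d] by simp
qed

end


section \<open>Coherent tree paths\<close>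

lemma tree_sum_cong:
  "(\<And>h. h \<in> trees_le M \<Longrightarrow> c h = c' h) \<Longrightarrow> tree_sum M c = tree_sum M c'"
  by (rule ext) (simp add: tree_sum_def)

lemma linear_proj_le: "linear (proj_le n)"
  unfolding proj_le_def by (rule linear_lin_ext)

lemma coeff_vec_component: "coeff_vec f Z $ i = Poly_Mapping.lookup (Z $ i) f"
  by (simp add: pair_vec_def dual_def)

lemma proj_le_eqI: "forest.eq_below (Suc n) x y \<Longrightarrow> proj_le n x = proj_le n y"
  by (rule poly_mapping_eqI) (simp add: lookup_proj_le forest.eq_below_def)

lemma compose_path_component:
  fixes g :: "real^'k \<Rightarrow> real^'k" and Y :: "real \<Rightarrow> ('d::finite forest_alg)^'k"
  assumes g: "class_C (N - 1) g"
  shows "compose_path N g Y s $ i = proj_le (N - 1) (taylor (N - 1) (coeff_vec {#} (Y s))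
    (tree_sum (N - 1) (\<lambda>h. coeff_vec {#h#} (Y s))) (\<lambda>z. g z $ i))"
proof -
  let ?y = "coeff_vec {#} (Y s)"
  let ?J = "\<lambda>p. shift (tree_sum (N - 1) (\<lambda>h. coeff_vec {#h#} (Y s))) p (eval_at ?y) (\<lambda>z. g z $ i)"
  have "{..N - 1} = insert 0 {1..N - 1}" by auto
  then have taylor: "taylor (N - 1) ?y (tree_sum (N - 1) (\<lambda>h. coeff_vec {#h#} (Y s))) (\<lambda>z. g z $ i) =
      (g ?y $ i) *\<^sub>R 1 + (\<Sum>p = 1..N - 1. (1 / fact p) *\<^sub>R ?J p)"
    by (simp add: taylor_def eval_at_def)
  have proj: "proj_le (N - 1) ((g ?y $ i) *\<^sub>R 1) = (g ?y $ i) *\<^sub>R 1"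
    by (rule poly_mapping_eqI) (auto simp: lookup_proj_le lookup_one when_def)
  have "compose_path N g Y s $ i = (g ?y $ i) *\<^sub>R 1 +
      proj_le (N - 1) (\<Sum>p = 1..N - 1. (1 / fact p) *\<^sub>R (deriv_expand N p g ?y (Y s) $ i))"
    by (simp add: compose_path_def vec_scale_def proj_vec_le_def sum_component)
  also have "(\<Sum>p = 1..N - 1. (1 / fact p) *\<^sub>R (deriv_expand N p g ?y (Y s) $ i)) =
      (\<Sum>p = 1..N - 1. (1 / fact p) *\<^sub>R ?J p)"
  proof (rule sum.cong[OF refl])
    fix p assume "p \<in> {1..N - 1}"
    then have "class_C p g" using g class_C_mono by auto
    then show "(1 / fact p) *\<^sub>R (deriv_expand N p g ?y (Y s) $ i) = (1 / fact p) *\<^sub>R ?J p"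
      by (simp add: deriv_expand_component)
  qed
  finally show ?thesis
    unfolding taylor linear_add[OF linear_proj_le] proj .
qed

context
  fixes N :: nat and \<sigma> :: "'d::finite \<Rightarrow> real^'k \<Rightarrow> real^'k"
    and Y :: "real \<Rightarrow> ('d forest_alg)^'k"
  assumes \<sigma>: "\<And>\<nu>. class_C (N - 1) (\<sigma> \<nu>)" and Y: "coherent N \<sigma> Y"
begin

text \<open>
  Coherence gives the coefficient at \<open>[f]\<^sub>\<mu>\<close> in terms of those at the trees of \<open>f\<close>, by the same recursion
  that defines the elementary differentials.
\<close>

lemma coherent_coeff:
  assumes "s \<in> {0<..1}" and "h \<in> trees_le (N - 1)"
  shows "coeff_vec {#h#} (Y s) = neldiff_tree \<sigma> h (coeff_vec {#} (Y s))"
  using assms(2)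
proof (induction h)
  case (Node \<mu> f)
  have f: "fsize f \<le> N - 1"
    using Node.prems by (simp add: trees_le_def vertices_Node del: vertices.simps)
  have "coeff_vec {#h#} (Y s) = neldiff_tree \<sigma> h (coeff_vec {#} (Y s))" if "h \<in># f" for h
    using that f order.trans[OF vertices_le_fsize[OF that]]
    by (intro Node.IH) (auto simp: trees_le_def)
  then have "coeff_vec f (compose_path N (\<sigma> \<mu>) Y s) = neldiff \<sigma> \<mu> f (coeff_vec {#} (Y s))"
    using f \<sigma>
    by (simp add: vec_eq_iff coeff_vec_component compose_path_component lookup_proj_le
        lookup_taylor_eldiff)
  moreover have "coeff_vec f (compose_path N (\<sigma> \<mu>) Y s) = coeff_vec {#Node \<mu> f#} (Y s)"
    using Y Node.prems assms(1) unfolding coherent_def by blast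
  ultimately show ?case by (simp add: neldiff_tree_Node)
qed

lemma coherent_compose_path:
  assumes "s \<in> {0<..1}"
  defines "y \<equiv> coeff_vec {#} (Y s)"
  shows "compose_path N (\<sigma> \<mu>) Y s $ i =
    proj_le (N - 1) (taylor (N - 1) y (eldiff_gen (N - 1) \<sigma> y) (\<lambda>x. \<sigma> \<mu> x $ i))"
proof -
  have "tree_sum (N - 1) (\<lambda>h. coeff_vec {#h#} (Y s)) = eldiff_gen (N - 1) \<sigma> y"
    unfolding y_def by (rule tree_sum_cong) (rule coherent_coeff[OF assms(1)])
  then show ?thesis
    by (simp add: compose_path_component[OF \<sigma>] y_def)
qed

lemma coherent_compose_path_coeff:
  assumes "s \<in> {0<..1}" and "fsize f \<le> N - 1"
  shows "coeff_vec f (compose_path N (\<sigma> \<mu>) Y s) = neldiff \<sigma> \<mu> f (coeff_vec {#} (Y s))"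
  using assms
  by (simp add: vec_eq_iff coeff_vec_component coherent_compose_path lookup_proj_le
      lookup_taylor_eldiff_gen[of "N - 1" \<sigma>, OF \<sigma>] del: One_nat_def)

end

lemma ord_ge_deriv_expand: "forest.ord_ge p (deriv_expand N p g y W $ i)"
proof -
  have "deriv_expand N p g y W $ i = (\<Sum>hs | length hs = p \<and> set hs \<subseteq> trees_le (N - 1).
      (nderiv g (map (\<lambda>h. coeff_vec {#h#} W) hs) y $ i) *\<^sub>R basis (mset hs))"
    by (simp add: deriv_expand_def vec_scale_def sum_component)
  moreover have "length hs \<le> fsize (mset hs)" for hs :: "'a rtree list"
    using size_le_fsize[of "mset hs"] by simp
  ultimately show ?thesis
    by (auto intro!: forest.ord_ge_sum forest.ord_ge_scaleR forest.ord_ge_basis)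
qed

lemma coeff_vec_neldiff_sum:
  fixes \<sigma> :: "'d::finite \<Rightarrow> real^'k \<Rightarrow> real^'k"
  assumes "h \<in> trees_le (N - 1)"
  shows "coeff_vec {#h#} (neldiff_sum N \<sigma> y) = neldiff_tree \<sigma> h y"
  by (simp add: vec_eq_iff coeff_vec_component neldiff_sum_component lookup_tree_sum_single[OF assms]
      del: One_nat_def)

text \<open>
  The function \<open>\<Upsilon>\<^sub>\<mu>[f]\<close> is of class \<open>C\<^sup>p\<close> for \<open>p \<le> N - 1 - |f|\<close>. For larger \<open>p\<close> the derivatives may be
  unspecified, but the forests in the corresponding term have at least \<open>p\<close> trees, and are removed by the truncation.
\<close>

lemma proj_le_deriv_expand:
  fixes \<sigma> :: "'d::finite \<Rightarrow> real^'k \<Rightarrow> real^'k"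
  assumes \<sigma>: "\<And>\<nu>. class_C (N - 1) (\<sigma> \<nu>)" and f: "fsize f \<le> N - 1"
  shows "proj_vec_le (N - fsize f - 1) (\<Sum>p=0..N - 1. (1 / fact p) *\<^sub>R
      deriv_expand N p (neldiff \<sigma> \<mu> f) y (neldiff_sum N \<sigma> y)) $ i =
    proj_le (N - 1 - fsize f)
      (taylor (N - 1) y (eldiff_gen (N - 1) \<sigma> y) (\<lambda>z. neldiff \<sigma> \<mu> f z $ i))"
proof -
  let ?M = "N - 1" and ?g = "neldiff \<sigma> \<mu> f"
  let ?J = "\<lambda>p. shift (eldiff_gen ?M \<sigma> y) p (eval_at y) (\<lambda>z. ?g z $ i)"
  have W: "tree_sum ?M (\<lambda>h. coeff_vec {#h#} (neldiff_sum N \<sigma> y)) = eldiff_gen ?M \<sigma> y"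
    by (rule tree_sum_cong) (rule coeff_vec_neldiff_sum)
  have "forest.eq_below (Suc (?M - fsize f)) (deriv_expand N p ?g y (neldiff_sum N \<sigma> y) $ i) (?J p)" for p
  proof (cases "p \<le> ?M - fsize f")
    case True
    then have "class_C p ?g"
      using class_C_mono[OF class_C_neldiff[of ?M \<sigma>, OF \<sigma> f]] by blast
    then show ?thesis by (simp add: deriv_expand_component W del: One_nat_def)
  next
    case False
    have "forest.eq_below p (deriv_expand N p ?g y (neldiff_sum N \<sigma> y) $ i) 0" "forest.eq_below p (?J p) 0"
      unfolding forest.ord_ge_iff[symmetric]
      by (rule ord_ge_deriv_expand, rule forest.ord_ge_jet[OF ord_ge_tree_sum])
    then have "forest.eq_below p (deriv_expand N p ?g y (neldiff_sum N \<sigma> y) $ i) (?J p)"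
      using forest.eq_below_trans forest.eq_below_sym by blast
    then show ?thesis by (rule forest.eq_below_mono) (use False in simp)
  qed
  then have "forest.eq_below (Suc (?M - fsize f))
      (\<Sum>p=0..?M. (1 / fact p) *\<^sub>R (deriv_expand N p ?g y (neldiff_sum N \<sigma> y) $ i))
      (taylor ?M y (eldiff_gen ?M \<sigma> y) (\<lambda>z. ?g z $ i))"
    unfolding taylor_def atMost_atLeast0
    by (intro forest.eq_below_sum forest.eq_below_scaleR)
  then show ?thesis
    by (simp add: proj_vec_le_def sum_component proj_le_eqI diff_commute)
qed


section \<open>Pairing with a rough path\<close>

lemma proj_le_eq_sum:
  fixes x :: "'d::finite forest_alg"
  shows "proj_le n x = (\<Sum>a | fsize a \<le> n. Poly_Mapping.lookup x a *\<^sub>R basis a)"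
proof -
  have "proj_le n x = (\<Sum>a | fsize a \<le> n. Poly_Mapping.lookup (proj_le n x) a *\<^sub>R basis a)"
    by (rule poly_mapping_eq_sum_basis[OF finite_forests_below])
      (auto simp: in_keys_iff lookup_proj_le split: if_splits)
  then show ?thesis by (simp add: lookup_proj_le)
qed

lemma character_sum:
  assumes \<phi>: "character N \<phi>" and "finite A" and "A \<subseteq> forests N"
  shows "\<phi> (\<Sum>a\<in>A. c a *\<^sub>R basis a) = (\<Sum>a\<in>A. c a * \<phi> (basis a))"
  using assms(2,3)
proof (induction A)
  case empty
  have "0 \<in> Span (forests N)" by (simp add: Span_def)
  then have "\<phi> (0 *\<^sub>R 0) = 0 * \<phi> 0" using \<phi> unfolding character_def by blast
  then show ?case by simp
next
  case (insert a A)
  have span: "(\<Sum>b\<in>B. c b *\<^sub>R basis b) \<in> Span (forests N)" if "B \<subseteq> forests N" for B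
    using that keys_sum[of "\<lambda>b. c b *\<^sub>R basis b" B]
    by (force simp: Span_def scaleR_basis split: if_splits)
  have "basis a \<in> Span (forests N)" using insert.prems by (simp add: Span_def)
  moreover have "c a *\<^sub>R basis a \<in> Span (forests N)" using span[of "{a}"] insert.prems by simp
  moreover have "(\<Sum>b\<in>A. c b *\<^sub>R basis b) \<in> Span (forests N)" using span insert.prems by simp
  ultimately have "\<phi> (c a *\<^sub>R basis a + (\<Sum>b\<in>A. c b *\<^sub>R basis b)) =
      c a * \<phi> (basis a) + \<phi> (\<Sum>b\<in>A. c b *\<^sub>R basis b)"
    using \<phi> unfolding character_def by simp
  then show ?case using insert by simp
qed

lemma tensor_pair_dual:
  fixes z :: "'d::finite forest_tensor"
  assumes z: "\<And>k. k \<in> Poly_Mapping.keys z \<Longrightarrow> tensor_size k \<le> M" and f: "fsize f \<le> M"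
  shows "tensor_pair \<phi> (dual f) z =
    (\<Sum>a | fsize a \<le> M - fsize f. Poly_Mapping.lookup z (a, f) * \<phi> (basis a))"
proof -
  let ?F = "{f :: 'd forest. fsize f \<le> M}"
  have fin: "finite ?F" by (rule finite_forests_below)
  have "tensor_pair \<phi> (dual f) z =
      (\<Sum>(a, b)\<in>?F \<times> ?F. Poly_Mapping.lookup z (a, b) * (\<phi> (basis a) * dual f (basis b)))"
    unfolding tensor_pair_def using fin z
    by (subst lin_ext_eq_sum[of "?F \<times> ?F"]) (fastforce simp: case_prod_unfold)+
  also have "\<dots> = (\<Sum>a\<in>?F. \<Sum>b\<in>?F. if b = f then Poly_Mapping.lookup z (a, f) * \<phi> (basis a) else 0)"
    unfolding sum.cartesian_product[symmetric]
    by (intro sum.cong refl) (auto simp: dual_def lookup_single when_def)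
  also have "\<dots> = (\<Sum>a\<in>?F. Poly_Mapping.lookup z (a, f) * \<phi> (basis a))"
    using fin f by simp
  also have "\<dots> = (\<Sum>a | fsize a \<le> M - fsize f. Poly_Mapping.lookup z (a, f) * \<phi> (basis a))"
  proof (rule sum.mono_neutral_right[OF fin])
    show "\<forall>a\<in>?F - {a. fsize a \<le> M - fsize f}. Poly_Mapping.lookup z (a, f) * \<phi> (basis a) = 0"
    proof
      fix a
      assume a: "a \<in> ?F - {a. fsize a \<le> M - fsize f}"
      have "(a, f) \<notin> Poly_Mapping.keys z"
      proof
        assume "(a, f) \<in> Poly_Mapping.keys z"
        then have "fsize a + fsize f \<le> M" using z by fastforce
        then show False using a by auto
      qed
      then show "Poly_Mapping.lookup z (a, f) * \<phi> (basis a) = 0" by (simp add: in_keys_iff)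
    qed
  qed auto
  finally show ?thesis .
qed

lemma keys_coprod_proj_le: "k \<in> Poly_Mapping.keys (coprod (proj_le n x)) \<Longrightarrow> tensor_size k \<le> n"
proof -
  assume "k \<in> Poly_Mapping.keys (coprod (proj_le n x))"
  then obtain f where f: "f \<in> Poly_Mapping.keys (proj_le n x)"
    and k: "k \<in> Poly_Mapping.keys (Poly_Mapping.lookup (proj_le n x) f *\<^sub>R coprod_forest f)"
    using subsetD[OF keys_sum, of k "\<lambda>f. Poly_Mapping.lookup (proj_le n x) f *\<^sub>R coprod_forest f"
        "Poly_Mapping.keys (proj_le n x)"]
    unfolding coprod_def lin_ext_def by blast
  have "k \<in> Poly_Mapping.keys (coprod_forest f)" using k by (auto simp: in_keys_iff)
  then have "tensor_size k = fsize f" by (rule coprod_forest_homogeneous)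
  then show ?thesis using f by (auto simp: in_keys_iff lookup_proj_le split: if_splits)
qed

theorem corollary3p9:
  fixes \<alpha> :: real and N :: nat
    and X :: "real \<Rightarrow> real \<Rightarrow> 'd::finite forest_alg \<Rightarrow> real"
    and \<sigma> :: "'d \<Rightarrow> real^'k \<Rightarrow> real^'k"
    and Y :: "real \<Rightarrow> ('d forest_alg)^'k"
    and f :: "'d forest" and \<mu> :: 'd and s t :: real
  assumes "0 < \<alpha>" and "\<alpha> < 1"
    and "real N * \<alpha> \<le> 1" and "1 < (real N + 1) * \<alpha>"
    and "rough_path \<alpha> N X"
    and "\<And>\<nu>. class_C N (\<sigma> \<nu>)"
    and "tree_path N Y" and "coherent N \<sigma> Y"
    and "f \<in> forests_le N (N - 1)"
    and "s \<in> {0<..1}" and "t \<in> {0<..1}"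
  shows "remainder X (compose_path N (\<sigma> \<mu>) Y) f s t =
     neldiff \<sigma> \<mu> f (coeff_vec {#} (Y t)) -
     pair_vec (X s t)
       (proj_vec_le (N - fsize f - 1)
         (\<Sum>p=0..N - 1. (1 / fact p) *\<^sub>R
            deriv_expand N p (neldiff \<sigma> \<mu> f) (coeff_vec {#} (Y s))
              (neldiff_sum N \<sigma> (coeff_vec {#} (Y s)))))"
proof -
  let ?M = "N - 1" and ?y = "coeff_vec {#} (Y s)"
  let ?P = "\<lambda>i. taylor ?M ?y (eldiff_gen ?M \<sigma> ?y) (\<lambda>x. \<sigma> \<mu> x $ i)"
  let ?Q = "\<lambda>i. taylor ?M ?y (eldiff_gen ?M \<sigma> ?y) (\<lambda>z. neldiff \<sigma> \<mu> f z $ i)"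
  have \<sigma>: "class_C ?M (\<sigma> \<nu>)" for \<nu>
    using assms(6) by (rule class_C_mono) simp
  have f: "fsize f \<le> ?M" using assms(9) by (simp add: forests_le_def)
  have X: "character N (X s t)" using assms(5,10,11) by (simp add: rough_path_def)
  have "tensor_pair (X s t) (dual f) (coprod (compose_path N (\<sigma> \<mu>) Y s $ i)) =
      X s t (proj_le (?M - fsize f) (?Q i))" for i
  proof -
    have "tensor_pair (X s t) (dual f) (coprod (compose_path N (\<sigma> \<mu>) Y s $ i)) =
        (\<Sum>a | fsize a \<le> ?M - fsize f.
          Poly_Mapping.lookup (coprod (proj_le ?M (?P i))) (a, f) * X s t (basis a))"
      unfolding coherent_compose_path[of N \<sigma>, OF \<sigma> assms(8,10)]
      by (rule tensor_pair_dual[OF keys_coprod_proj_le f])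
    also have "\<dots> = (\<Sum>a | fsize a \<le> ?M - fsize f. Poly_Mapping.lookup (?Q i) a * X s t (basis a))"
    proof (intro sum.cong refl)
      fix a :: "'d forest"
      assume "a \<in> {a. fsize a \<le> ?M - fsize f}"
      then have a: "fsize a + fsize f \<le> ?M" using f by simp
      have "forest.eq_below (Suc ?M) (proj_le ?M (?P i)) (?P i)"
        by (simp add: forest.eq_below_def lookup_proj_le)
      then have "Poly_Mapping.lookup (coprod (proj_le ?M (?P i))) (a, f) =
          Poly_Mapping.lookup (coprod (?P i)) (a, f)"
        using eq_below_coprod a by (fastforce simp: tensor.eq_below_def)
      then show "Poly_Mapping.lookup (coprod (proj_le ?M (?P i))) (a, f) * X s t (basis a) =
          Poly_Mapping.lookup (?Q i) a * X s t (basis a)"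
        using lookup_coprod_taylor[of ?M \<sigma>, OF \<sigma> a] by simp
    qed
    also have "\<dots> = X s t (proj_le (?M - fsize f) (?Q i))"
    proof -
      have "{a :: 'd forest. fsize a \<le> ?M - fsize f} \<subseteq> forests N"
        using order.trans[OF vertices_le_fsize] by (fastforce simp: forests_def trees_le_def)
      then show ?thesis
        unfolding proj_le_eq_sum by (intro character_sum[OF X finite_forests_below, symmetric])
    qed
    finally show ?thesis .
  qed
  then show ?thesis
    unfolding remainder_def coherent_compose_path_coeff[of N \<sigma>, OF \<sigma> assms(8,11) f]
    by (simp only: pair_vec_def[of "X s t"] proj_le_deriv_expand[of N \<sigma>, OF \<sigma> f])
qed

end
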